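(* Let $a \neq 0$ be a purely imaginary complex number, i.e. $\Re a = 0$. Let $\nu$ and $\mu$ be two complex numbers such that $\Re \mu > 0$. Then, for every complex number $z$ with $\Re z > 0$, $$\frac{a^{\frac{\nu}{2}-\frac{\mu}{2}}}{(-a)^{\frac{\nu}{2}}}\, D_{-\nu}\left(\frac{z}{\sqrt{-a}}\right) D_{\nu-\mu}\left(\frac{z}{\sqrt{a}}\right) = \frac{1}{\Gamma(\mu)} \int_0^{+\infty} x^{\mu-1} e^{-zx-\frac{1}{2}ax^2}\, \Phi\left(\nu, \mu; ax^2\right) dx .$$
   Context: $\Phi$ is Kummer's confluent hypergeometric function of the first kind, $\Phi(\nu,\mu;z)=\sum_{n=0}^{\infty}\frac{(\nu)_n}{(\mu)_n}\frac{z^n}{n!}$, where $(\nu)_n=\Gamma(\nu+n)/\Gamma(\nu)=\nu(\nu+1)\cdots(\nu+n-1)$ is the Pochhammer symbol. $D_\nu$ is the parabolic cylinder function, the entire function of $z\in\mathbb{C}$ (and of $\nu\in\mathbb{C}$) defined by $$D_\nu(z)=2^{\nu/2}e^{-z^2/4}\left(\frac{\sqrt{\pi}}{\Gamma(\frac12-\frac{\nu}{2})}\Phi\left(-\tfrac{\nu}{2},\tfrac12;\tfrac{z^2}{2}\right)-\frac{\sqrt{2\pi}\,z}{\Gamma(-\frac{\nu}{2})}\Phi\left(\tfrac12-\tfrac{\nu}{2},\tfrac32;\tfrac{z^2}{2}\right)\right),$$ with $1/\Gamma$ taken to be $0$ at the poles of $\Gamma$. Complex powers and square roots are principal branches. 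*)

theory Defs
  imports "HOL-Analysis.Analysis"
begin

text \<open>
  Kummer's function $\Phi(\nu,\mu;z)$. For $\mu$ a nonpositive integer, where $\Phi$ is undefined,
  the value is an artefact of division by zero.
\<close>
definition kummer_Phi :: "complex \<Rightarrow> complex \<Rightarrow> complex \<Rightarrow> complex" where
  "kummer_Phi \<nu> \<mu> z = (\<Sum>n. pochhammer \<nu> n / pochhammer \<mu> n * (z ^ n / fact n))"

text \<open>
  The parabolic cylinder function $D_\nu(z)$. The entire function \<^const>\<open>rGamma\<close> is $1/\Gamma$,
  with value $0$ at the poles of $\Gamma$.
\<close>
definition parabolic_cylinder_D :: "complex \<Rightarrow> complex \<Rightarrow> complex" where
  "parabolic_cylinder_D \<nu> z =
     2 powr (\<nu> / 2) * exp (- (z ^ 2) / 4) *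
       (of_real (sqrt pi) * rGamma (1 / 2 - \<nu> / 2) * kummer_Phi (- \<nu> / 2) (1 / 2) (z ^ 2 / 2)
        - of_real (sqrt (2 * pi)) * z * rGamma (- \<nu> / 2) *
            kummer_Phi (1 / 2 - \<nu> / 2) (3 / 2) (z ^ 2 / 2))"

end

theory Submission
  imports Defs "HOL-Complex_Analysis.Complex_Analysis"
begin

text \<open>
  Expanding $e^{-zs}$ gives, first for $a > 0$, then by analytic continuation for
  $\Re a > 0$ and by dominated convergence for $\Re a = 0$, the Laplace transform
  $\int_0^\infty s^{\nu-1} e^{-zs-as^2/2}\,ds
    = \Gamma(\nu) a^{-\nu/2} e^{z^2/(4a)} D_{-\nu}(z/\sqrt a)$ for $\Re\nu > 0$.
  If $0 < \Re\nu < \Re\mu$, the product of the two $D$'s is therefore a double integral over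
  $s, t > 0$ of $s^{\nu-1} t^{\mu-\nu-1} e^{-z(s+t)-a(t^2-s^2)/2}$; with $x = s + t$ and $s = xu$ the
  integral over $u$ is Euler's integral for $\Phi(\nu,\mu;ax^2)$. Both sides are entire in $\nu$, because
  on the imaginary axis $\Phi(\nu,\mu;\cdot)$ grows at most polynomially, locally uniformly in $\nu$;
  so the identity extends to all $\nu$.
\<close>

subsection \<open>Parameter integrals and integrals over the positive half-line\<close>

text \<open>The two Laplace factors carry the parameters -a and a, and the transform is available
  only for nonnegative real part; so a lies on the imaginary axis, the boundary of the region of
  Gaussian decay. There only e^{-zs} with Re z > 0 gives decay, and its expansion in powers of s
  cannot be integrated term by term; hence the detour through real a > 0. Since the parameters are
  opposite, the factors e^{z^2/(4a)} and e^{-z^2/(4a)} of the two transforms cancel, which leaves no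
  exponential beside the two D's. The obstacle in the continuation in \<nu> is a dominating function
  that is uniform for \<nu> in a disc. Estimating the power series of \<Phi>(\<nu>,\<mu>;ax^2) term
  by term gives growth of roughly e^{|a|x^2}, which e^{-zx} cannot absorb. An energy estimate for
  Kummer's equation takes its place.\<close>

lemma holomorphic_on_lebesgue_integral:
  fixes f :: "complex \<Rightarrow> 'a \<Rightarrow> complex"
  assumes "open S"
    and meas: "\<And>w. w \<in> S \<Longrightarrow> f w \<in> borel_measurable M"
    and hol: "\<And>x. x \<in> space M \<Longrightarrow> (\<lambda>w. f w x) holomorphic_on S"
    and bound: "\<And>w. w \<in> S \<Longrightarrow> \<exists>r>0. \<exists>g. cball w r \<subseteq> S \<and> integrable M g \<and>
                  (\<forall>u\<in>cball w r. \<forall>x\<in>space M. norm (f u x) \<le> g x)"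
  shows "(\<lambda>w. \<integral>x. f w x \<partial>M) holomorphic_on S"
proof (rule holomorphic_onI)
  fix w assume "w \<in> S"
  then obtain r g where r: "r > 0" "cball w r \<subseteq> S" and g: "integrable M g"
    and fg: "\<And>u x. u \<in> cball w r \<Longrightarrow> x \<in> space M \<Longrightarrow> norm (f u x) \<le> g x"
    using bound by blast
  define D where "D = (\<lambda>x. deriv (\<lambda>u. f u x) w)"
  have int: "integrable M (f u)" if "u \<in> cball w r" for u
    using that r by (intro Bochner_Integration.integrable_bound[OF g meas] AE_I2)
      (auto intro: order_trans[OF fg abs_ge_self])
  have diff: "((\<lambda>u. f u x) has_field_derivative deriv (\<lambda>u. f u x) u) (at u)"
    if "x \<in> space M" "u \<in> S" for x u
    using holomorphic_derivI[OF hol] that \<open>open S\<close> by blast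
  \<comment> \<open>Cauchy's inequality on discs of radius r/2 turns the bound \<open>g\<close> on
    \<open>f\<close> into the bound 2g/r on its derivative, so the difference quotients are
    dominated as well.\<close>
  have lip: "norm (f u x - f w x) \<le> 2 * g x / r * norm (u - w)"
    if "u \<in> ball w (r / 2)" "x \<in> space M" for u x
  proof (rule field_differentiable_bound[OF convex_ball])
    fix v assume v: "v \<in> ball w (r / 2)"
    have "cball v (r / 2) \<subseteq> cball w r"
      using v by (simp add: cball_subset_cball_iff dist_commute)
    with r have sub: "cball v (r / 2) \<subseteq> S" by blast
    have h: "(\<lambda>u. f u x) holomorphic_on cball v (r / 2)"
      using holomorphic_on_subset[OF hol sub] that by blast
    have "norm ((deriv ^^ 1) (\<lambda>u. f u x) v) \<le> fact 1 * g x / (r / 2) ^ 1"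
    proof (rule Cauchy_inequality)
      show "norm (f u x) \<le> g x" if "norm (v - u) = r / 2" for u
        using that \<open>cball v (r / 2) \<subseteq> cball w r\<close> \<open>x \<in> space M\<close>
        by (intro fg) (auto simp: dist_norm)
    qed (use h r in \<open>auto intro: holomorphic_on_imp_continuous_on holomorphic_on_subset[OF h]\<close>)
    then show "norm (deriv (\<lambda>u. f u x) v) \<le> 2 * g x / r"
      by (simp add: mult.commute)
    have "v \<in> S" using subsetD[OF sub, of v] r by simp
    then show "((\<lambda>u. f u x) has_field_derivative deriv (\<lambda>u. f u x) v) (at v within ball w (r / 2))"
      by (rule has_field_derivative_at_within[OF diff[OF that(2)]])
  qed (use that r in auto)
  have "((\<lambda>w. \<integral>x. f w x \<partial>M) has_field_derivative (\<integral>x. D x \<partial>M)) (at w)"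
    unfolding has_field_derivative_iff tendsto_at_iff_sequentially
  proof (intro allI impI)
    \<comment> \<open>Dominated convergence is about sequences, so the limit is tested along
      \<open>X\<close>; dropping the first \<open>N\<close> terms keeps the points in the ball where
      \<open>lip\<close> applies.\<close>
    fix X assume X: "\<forall>i. X i \<in> UNIV - {w}" "X \<longlonglongrightarrow> w"
    then obtain N where N: "\<And>n. n \<ge> N \<Longrightarrow> X n \<in> ball w (r / 2)"
      using r unfolding lim_sequentially mem_ball by (metis dist_commute half_gt_zero)
    have lim: "(\<lambda>n. (f (X (n + N)) x - f w x) / (X (n + N) - w)) \<longlonglongrightarrow> D x"
      if "x \<in> space M" for x
    proof -
      have "(\<lambda>n. (f (X n) x - f w x) / (X n - w)) \<longlonglongrightarrow> D x"
        using diff[OF that \<open>w \<in> S\<close>] X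
        unfolding has_field_derivative_iff tendsto_at_iff_sequentially D_def o_def by blast
      then show ?thesis by (rule LIMSEQ_ignore_initial_segment)
    qed
    have XS: "X (n + N) \<in> cball w r" for n
      using N[of "n + N"] r by auto
    have "(\<lambda>n. \<integral>x. (f (X (n + N)) x - f w x) / (X (n + N) - w) \<partial>M) \<longlonglongrightarrow> (\<integral>x. D x \<partial>M)"
    proof (rule integral_dominated_convergence)
      show m: "(\<lambda>x. (f (X (n + N)) x - f w x) / (X (n + N) - w)) \<in> borel_measurable M" for n
        using meas[of w] meas[of "X (n + N)"] XS[of n] r \<open>w \<in> S\<close> by (auto intro!: borel_measurable_divide borel_measurable_diff)
      show "D \<in> borel_measurable M"
        using m lim by (rule borel_measurable_LIMSEQ_metric)
      show "integrable M (\<lambda>x. 2 * g x / r)" using g by simp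
      show "AE x in M. norm ((f (X (n + N)) x - f w x) / (X (n + N) - w)) \<le> 2 * g x / r" for n
        using lip[OF N[of "n + N"]] X(1)
        by (intro AE_I2) (auto simp: norm_divide divide_le_eq)
    qed (use lim in auto)
    moreover have "(\<integral>x. (f (X (n + N)) x - f w x) / (X (n + N) - w) \<partial>M) =
       ((\<integral>x. f (X (n + N)) x \<partial>M) - (\<integral>x. f w x \<partial>M)) / (X (n + N) - w)" for n
      using int[of w] int[OF XS] r by simp
    ultimately have "(\<lambda>n. ((\<lambda>y. ((\<integral>x. f y x \<partial>M) - (\<integral>x. f w x \<partial>M)) / (y - w)) \<circ> X) (n + N)) \<longlonglongrightarrow> (\<integral>x. D x \<partial>M)"
      by (simp only: o_def)
    then show "((\<lambda>y. ((\<integral>x. f y x \<partial>M) - (\<integral>x. f w x \<partial>M)) / (y - w)) \<circ> X) \<longlonglongrightarrow> (\<integral>x. D x \<partial>M)"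
      by (rule LIMSEQ_offset)
  qed
  then show "(\<lambda>w. \<integral>x. f w x \<partial>M) field_differentiable at w within S"
    using field_differentiable_at_within field_differentiable_def by blast
qed

section \<open>Termwise integration of an exponential series\<close>

lemma sum_power_le_exp:
  fixes y :: real
  assumes "y \<ge> 0"
  shows "(\<Sum>i<n. y ^ i / fact i) \<le> exp y"
proof -
  have "(\<lambda>i. y ^ i / fact i) sums exp y"
    using exp_converges[of y] by (simp add: divide_inverse mult.commute)
  then show ?thesis
    using assms sum_le_suminf[of "\<lambda>i. y ^ i / fact i" "{..<n}"] by (simp add: sums_iff)
qed

text \<open>Dominated convergence, as |g| e^{|h|} majorizes all partial sums. It serves for e^{-zs}
  against a Gaussian and for e^{bu} in Euler's integral.\<close>

lemma sums_integral_exp: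
  fixes g h :: "'a \<Rightarrow> complex"
  assumes [measurable]: "g \<in> borel_measurable M" "h \<in> borel_measurable M"
    and int: "integrable M (\<lambda>x. norm (g x) * exp (norm (h x)))"
  shows "(\<lambda>n. \<integral>x. g x * h x ^ n / fact n \<partial>M) sums (\<integral>x. g x * exp (h x) \<partial>M)"
proof -
  \<comment> \<open>With an arbitrary index set one estimate does two jobs: a singleton gives the
    integrability of each term, \<open>{..<n}\<close> the domination of the partial sums.\<close>
  have le: "(\<Sum>i\<in>I. norm (g x * h x ^ i / fact i)) \<le> norm (g x) * exp (norm (h x))"
    if "I \<subseteq> {..<n}" for x I n
  proof -
    have "(\<Sum>i\<in>I. norm (g x * h x ^ i / fact i)) \<le> (\<Sum>i<n. norm (g x * h x ^ i / fact i))"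
      using that by (intro sum_mono2) auto
    also have "\<dots> = norm (g x) * (\<Sum>i<n. norm (h x) ^ i / fact i)"
      by (simp add: sum_distrib_left norm_mult norm_divide norm_power)
    also have "\<dots> \<le> norm (g x) * exp (norm (h x))"
      by (intro mult_left_mono sum_power_le_exp) auto
    finally show ?thesis .
  qed
  have intn: "integrable M (\<lambda>x. g x * h x ^ n / fact n)" for n
    using le[of "{n}" "Suc n"]
    by (intro Bochner_Integration.integrable_bound[OF int] AE_I2) auto
  have "(\<lambda>n. \<integral>x. (\<Sum>i<n. g x * h x ^ i / fact i) \<partial>M) \<longlonglongrightarrow> (\<integral>x. g x * exp (h x) \<partial>M)"
  proof (rule integral_dominated_convergence[OF _ _ int])
    have "(\<lambda>n. g x * h x ^ n / fact n) sums (g x * exp (h x))" for x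
      using sums_mult[OF exp_converges[of "h x"], of "g x"]
      by (simp add: scaleR_conv_of_real field_simps)
    then show "AE x in M. (\<lambda>n. \<Sum>i<n. g x * h x ^ i / fact i) \<longlonglongrightarrow> g x * exp (h x)"
      by (simp add: sums_def)
    show "AE x in M. norm (\<Sum>i<n. g x * h x ^ i / fact i) \<le> norm (g x) * exp (norm (h x))" for n
      by (intro AE_I2 order_trans[OF norm_sum le]) auto
  qed auto
  then show ?thesis
    using intn by (simp add: sums_def)
qed

section \<open>Integrability on the half-line\<close>

lemma set_integrable_iff_restrict_space:
  fixes f :: "real \<Rightarrow> complex"
  assumes "A \<in> sets borel"
  shows "set_integrable lborel A f \<longleftrightarrow> integrable (restrict_space lborel A) f"
  using assms by (simp add: set_integrable_def integrable_restrict_space)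

lemma set_lebesgue_integral_restrict_space:
  fixes f :: "real \<Rightarrow> complex"
  assumes "A \<in> sets borel"
  shows "(LINT x:A|lborel. f x) = integral\<^sup>L (restrict_space lborel A) f"
  using assms by (simp add: set_lebesgue_integral_def integral_restrict_space)

lemma borel_measurable_restrict_lborel:
  fixes f :: "real \<Rightarrow> complex"
  assumes "continuous_on A f"
  shows "f \<in> borel_measurable (restrict_space lborel A)"
  using borel_measurable_continuous_on_restrict[OF assms]
  by (simp cong: measurable_cong_sets add: sets_restrict_space)

lemma powr_exp_integrable:
  fixes c \<zeta> :: real
  assumes "c > 0" "\<zeta> > 0"
  shows "integrable (restrict_space lborel {0<..}) (\<lambda>x. x powr (c - 1) * exp (- \<zeta> * x))"
proof -
  let ?f = "\<lambda>t. complex_of_real t powr (of_real c - 1) / of_real (exp (\<zeta> * t))"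
  have "set_integrable lebesgue {0<..} ?f"
    using absolutely_integrable_Gamma_integral[of "of_real c" \<zeta>] assms by simp
  moreover have "continuous_on {0<..} ?f"
    by (auto intro!: continuous_intros simp: complex_nonpos_Reals_iff)
  then have "(\<lambda>x. indicat_real {0<..} x *\<^sub>R ?f x) \<in> borel_measurable borel"
    using borel_measurable_continuous_on_indicator[of "{0<..}" ?f] by simp
  \<comment> \<open>The Gamma integral is given for the completed measure; continuity makes the
    integrand Borel measurable, which permits the descent from \<open>lebesgue\<close> to
    \<open>lborel\<close>.\<close>
  ultimately have "set_integrable lborel {0<..} ?f"
    unfolding set_integrable_def by (subst (asm) integrable_completion) auto
  then have "integrable (restrict_space lborel {0<..}) (\<lambda>x. norm (?f x))"
    by (subst (asm) set_integrable_iff_restrict_space) auto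
  then show ?thesis
    by (rule Bochner_Integration.integrable_cong[THEN iffD1, rotated 2])
      (auto simp: space_restrict_space norm_divide norm_powr_real_powr exp_minus field_simps)
qed

lemma integrable_powr_exp_bound:
  fixes f :: "real \<Rightarrow> complex"
  assumes "c > 0" "\<zeta> > 0" "continuous_on {0<..} f"
    and "\<And>x. x > 0 \<Longrightarrow> norm (f x) \<le> C * (x powr (c - 1) * exp (- \<zeta> * x))"
  shows "integrable (restrict_space lborel {0<..}) f"
proof (rule Bochner_Integration.integrable_bound)
  show "integrable (restrict_space lborel {0<..}) (\<lambda>x. C * (x powr (c - 1) * exp (- \<zeta> * x)))"
    by (intro integrable_mult_right powr_exp_integrable assms)
  show "f \<in> borel_measurable (restrict_space lborel {0<..})"
    by (rule borel_measurable_restrict_lborel) fact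
qed (use assms(4) in \<open>auto simp: space_restrict_space intro!: AE_I2 order_trans[OF _ abs_ge_self]\<close>)

subsection \<open>Kummer's function\<close>

text \<open>One bound for all |\<nu>| \<le> R and |z| \<le> r. That \<nu> enters only through R is
  what makes the later constants locally uniform in \<nu>.\<close>

definition kummer_majorant :: "real \<Rightarrow> complex \<Rightarrow> real \<Rightarrow> real" where
  "kummer_majorant R \<mu> r = (\<Sum>n. pochhammer R n / norm (pochhammer \<mu> n) * (r ^ n / fact n))"

lemma summable_kummer_majorant:
  fixes R r :: real and \<mu> :: complex
  assumes "R \<ge> 0" "r \<ge> 0"
  shows "summable (\<lambda>n. pochhammer R n / norm (pochhammer \<mu> n) * (r ^ n / fact n))"
proof -
  have nonneg: "pochhammer R n \<ge> 0" for n
    unfolding pochhammer_prod using assms by (intro prod_nonneg) auto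
  define f where "f = (\<lambda>n. pochhammer R n / norm (pochhammer \<mu> n) * (r ^ n / fact n))"
  \<comment> \<open>The summands serve in turn: 2|\<mu>| gives |\<mu> + n| \<ge> n/2, R gives R + n
    \<le> 2n, 6r brings the ratio 4r/(1 + n) down to 2/3, and 1 keeps n nonzero.\<close>
  obtain N :: nat where N: "real N \<ge> 2 * norm \<mu> + R + 6 * r + 1"
    using real_arch_simple by blast
  have "summable f"
  proof (rule summable_ratio_test)
    fix n assume "n \<ge> N"
    then have n: "real n \<ge> 2 * norm \<mu> + R + 6 * r + 1" using N by linarith
    have "norm (\<mu> + of_nat n) \<ge> real n - norm \<mu>"
      using norm_triangle_ineq4[of "\<mu> + of_nat n" \<mu>] by simp
    then have mu: "norm (\<mu> + of_nat n) \<ge> real n / 2"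
      using n assms norm_ge_zero[of \<mu>] by argo
    have "(R + n) / norm (\<mu> + of_nat n) * (r / (1 + n)) \<le> (2 * n) / (n / 2) * (r / (1 + n))"
      using mu n assms norm_ge_zero[of \<mu>]
      by (intro mult_right_mono frac_le divide_nonneg_nonneg) linarith+
    also have "\<dots> = 4 * r / (1 + n)"
    proof -
      have "n \<noteq> 0" using n assms norm_ge_zero[of \<mu>] by (intro notI) simp
      then show ?thesis by (simp add: field_simps)
    qed
    also have "\<dots> \<le> 2 / 3"
    proof -
      have "6 * r \<le> n" using n assms norm_ge_zero[of \<mu>] by linarith
      then show ?thesis by (simp add: divide_le_eq)
    qed
    finally have "(R + n) / norm (\<mu> + of_nat n) * (r / (1 + n)) * f n \<le> 2 / 3 * f n"
      using assms by (intro mult_right_mono) (auto simp: f_def nonneg)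
    moreover have "f (Suc n) = (R + n) / norm (\<mu> + of_nat n) * (r / (1 + n)) * f n"
      by (simp add: f_def pochhammer_Suc norm_mult mult_ac add_ac)
    moreover have "f n \<ge> 0" "f (Suc n) \<ge> 0"
      using assms by (auto simp: f_def nonneg)
    ultimately show "norm (f (Suc n)) \<le> 2 / 3 * norm (f n)" by simp
  qed auto
  then show ?thesis by (simp add: f_def)
qed

lemma norm_kummer_term_le:
  fixes \<nu> \<mu> z :: complex
  assumes "norm \<nu> \<le> R" "norm z \<le> r"
  shows "norm (pochhammer \<nu> n / pochhammer \<mu> n * (z ^ n / fact n))
           \<le> pochhammer R n / norm (pochhammer \<mu> n) * (r ^ n / fact n)"
proof -
  have "norm (pochhammer \<nu> n) \<le> pochhammer R n"
    unfolding pochhammer_prod prod_norm[symmetric]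
    using assms by (intro prod_mono) (auto intro!: order_trans[OF norm_triangle_ineq])
  moreover have "norm z ^ n \<le> r ^ n" using assms by (intro power_mono) auto
  ultimately show ?thesis
    using norm_ge_zero[of z] assms
    by (simp add: norm_mult norm_divide norm_power) (intro mult_mono divide_right_mono, auto intro!: divide_nonneg_nonneg order_trans[OF norm_ge_zero])
qed

lemma summable_norm_kummer:
  fixes \<nu> \<mu> z :: complex
  shows "summable (\<lambda>n. norm (pochhammer \<nu> n / pochhammer \<mu> n * (z ^ n / fact n)))"
proof (rule summable_comparison_test')
  show "summable (\<lambda>n. pochhammer (norm \<nu>) n / norm (pochhammer \<mu> n) * (norm z ^ n / fact n))"
    by (rule summable_kummer_majorant) auto
  show "norm (norm (pochhammer \<nu> n / pochhammer \<mu> n * (z ^ n / fact n)))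
      \<le> pochhammer (norm \<nu>) n / norm (pochhammer \<mu> n) * (norm z ^ n / fact n)" for n
    unfolding real_norm_def abs_norm_cancel by (rule norm_kummer_term_le) auto
qed

lemmas summable_kummer = summable_norm_cancel[OF summable_norm_kummer]

lemma kummer_sums:
  "(\<lambda>n. pochhammer \<nu> n / pochhammer \<mu> n * (z ^ n / fact n)) sums kummer_Phi \<nu> \<mu> z"
  unfolding kummer_Phi_def by (rule summable_sums[OF summable_kummer])

lemma norm_kummer_Phi_le:
  assumes "norm \<nu> \<le> R" "norm z \<le> r"
  shows "norm (kummer_Phi \<nu> \<mu> z) \<le> kummer_majorant R \<mu> r"
  unfolding kummer_Phi_def kummer_majorant_def
proof (rule norm_suminf_le)
  show "summable (\<lambda>n. pochhammer R n / norm (pochhammer \<mu> n) * (r ^ n / fact n))"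
    using assms order_trans[OF norm_ge_zero] by (intro summable_kummer_majorant) blast+
qed (use assms norm_kummer_term_le in blast)

lemma holomorphic_on_kummer_Phi_param:
  "(\<lambda>\<nu>. kummer_Phi \<nu> \<mu> z) holomorphic_on UNIV"
proof (rule holomorphic_uniform_sequence)
  fix \<nu> :: complex
  have "uniform_limit (cball \<nu> 1)
          (\<lambda>N \<nu>. \<Sum>n<N. pochhammer \<nu> n / pochhammer \<mu> n * (z ^ n / fact n))
          (\<lambda>\<nu>. \<Sum>n. pochhammer \<nu> n / pochhammer \<mu> n * (z ^ n / fact n)) sequentially"
  proof (rule Weierstrass_m_test)
    fix n and w :: complex assume "w \<in> cball \<nu> 1"
    then have "norm w \<le> norm \<nu> + 1"
      using norm_triangle_ineq2[of w \<nu>] by (simp add: dist_norm norm_minus_commute)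
    then show "norm (pochhammer w n / pochhammer \<mu> n * (z ^ n / fact n)) \<le>
        pochhammer (norm \<nu> + 1) n / norm (pochhammer \<mu> n) * (norm z ^ n / fact n)"
      by (rule norm_kummer_term_le) simp
  qed (intro summable_kummer_majorant, auto)
  then show "\<exists>d>0. cball \<nu> d \<subseteq> UNIV \<and> uniform_limit (cball \<nu> d)
      (\<lambda>N \<nu>. \<Sum>n<N. pochhammer \<nu> n / pochhammer \<mu> n * (z ^ n / fact n))
      (\<lambda>\<nu>. kummer_Phi \<nu> \<mu> z) sequentially"
    unfolding kummer_Phi_def by (intro exI[of _ 1]) auto
next
  show "(\<lambda>\<nu>. \<Sum>n<N. pochhammer \<nu> n / pochhammer \<mu> n * (z ^ n / fact n)) holomorphic_on UNIV" for N
    by (simp add: divide_inverse) (intro holomorphic_intros holomorphic_pochhammer)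
qed auto

lemma holomorphic_on_kummer_Phi_param' [holomorphic_intros]:
  assumes "f holomorphic_on A"
  shows "(\<lambda>w. kummer_Phi (f w) \<mu> z) holomorphic_on A"
  using holomorphic_on_compose_gen[OF assms holomorphic_on_kummer_Phi_param] by (simp add: o_def)

text \<open>Termwise differentiation; \<open>pochhammer_rec\<close> splits \<nu>/\<mu> off each
  coefficient and shifts both parameters by one.\<close>

lemma has_field_derivative_kummer_Phi:
  "(kummer_Phi \<nu> \<mu> has_field_derivative \<nu> / \<mu> * kummer_Phi (\<nu> + 1) (\<mu> + 1) z) (at z)"
proof -
  define c where "c = (\<lambda>n. pochhammer \<nu> n / pochhammer \<mu> n / fact n)"
  have Phi: "kummer_Phi \<nu> \<mu> = (\<lambda>z. \<Sum>n. c n * z ^ n)"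
    by (simp add: fun_eq_iff kummer_Phi_def c_def)
  have "summable (\<lambda>n. c n * z ^ n)" for z
    using summable_kummer[of \<nu> \<mu> z] by (simp add: c_def)
  then have "(kummer_Phi \<nu> \<mu> has_field_derivative (\<Sum>n. diffs c n * z ^ n)) (at z)"
    unfolding Phi by (rule termdiffs_strong_converges_everywhere)
  also have "(\<lambda>n. diffs c n * z ^ n) =
      (\<lambda>n. \<nu> / \<mu> * (pochhammer (\<nu> + 1) n / pochhammer (\<mu> + 1) n * (z ^ n / fact n)))"
  proof
    fix n
    have "diffs c n = of_nat (Suc n) * (pochhammer \<nu> (Suc n) / pochhammer \<mu> (Suc n) / fact (Suc n))"
      by (simp only: diffs_def c_def)
    also have "\<dots> = pochhammer \<nu> (Suc n) / pochhammer \<mu> (Suc n) / fact n"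
      by (simp add: fact_Suc del: of_nat_Suc)
    finally have "diffs c n = \<nu> / \<mu> * (pochhammer (\<nu> + 1) n / pochhammer (\<mu> + 1) n * (1 / fact n))"
      by (simp add: pochhammer_rec)
    then show "diffs c n * z ^ n = \<nu> / \<mu> * (pochhammer (\<nu> + 1) n / pochhammer (\<mu> + 1) n * (z ^ n / fact n))"
      by simp
  qed
  also have "(\<Sum>n. \<dots> n) = \<nu> / \<mu> * kummer_Phi (\<nu> + 1) (\<mu> + 1) z"
    by (rule sums_unique[OF sums_mult[OF kummer_sums], symmetric])
  finally show ?thesis .
qed

lemma holomorphic_on_kummer_Phi [holomorphic_intros]:
  assumes "f holomorphic_on A"
  shows "(\<lambda>w. kummer_Phi \<nu> \<mu> (f w)) holomorphic_on A"
proof -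
  have "kummer_Phi \<nu> \<mu> holomorphic_on UNIV"
    using has_field_derivative_kummer_Phi
    unfolding holomorphic_on_def field_differentiable_def by (metis has_field_derivative_at_within)
  from holomorphic_on_compose_gen[OF assms this] show ?thesis by (simp add: o_def)
qed

lemma continuous_on_kummer_Phi [continuous_intros]:
  assumes "continuous_on A f"
  shows "continuous_on A (\<lambda>w. kummer_Phi \<nu> \<mu> (f w))"
proof -
  have "continuous_on UNIV (kummer_Phi \<nu> \<mu>)"
    using holomorphic_on_imp_continuous_on[OF holomorphic_on_kummer_Phi[OF holomorphic_on_ident]] .
  from continuous_on_compose2[OF this assms] show ?thesis by simp
qed

text \<open>
  This is Kummer's equation after $\Phi'$ and $\Phi''$ have been
  replaced by shifted functions and a factor $\nu/\mu$ has been cancelled.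
\<close>

lemma kummer_contiguous:
  assumes "\<mu> \<notin> \<int>\<^sub>\<le>\<^sub>0"
  shows "(\<nu> + 1) / (\<mu> + 1) * z * kummer_Phi (\<nu> + 2) (\<mu> + 2) z
           + (\<mu> - z) * kummer_Phi (\<nu> + 1) (\<mu> + 1) z = \<mu> * kummer_Phi \<nu> \<mu> z"
proof -
  let ?t = "\<lambda>\<nu> \<mu> n. pochhammer \<nu> n / pochhammer \<mu> n * (z ^ n / fact n) :: complex"
  have nz: "\<mu> + of_nat k \<noteq> 0" for k
    using assms by (metis add.inverse_inverse eq_neg_iff_add_eq_0 minus_of_nat_in_nonpos_Ints)
  \<comment> \<open>Coefficients of z^(n+1) are compared: series with an explicit factor z keep the
    index n, the others move to \<open>Suc n\<close> after their constant term 1 is split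
    off.\<close>
  have "(\<lambda>n. (\<nu> + 1) / (\<mu> + 1) * z * ?t (\<nu> + 2) (\<mu> + 2) n + \<mu> * ?t (\<nu> + 1) (\<mu> + 1) (Suc n)
              - z * ?t (\<nu> + 1) (\<mu> + 1) n) sums
        ((\<nu> + 1) / (\<mu> + 1) * z * kummer_Phi (\<nu> + 2) (\<mu> + 2) z
          + \<mu> * (kummer_Phi (\<nu> + 1) (\<mu> + 1) z - 1) - z * kummer_Phi (\<nu> + 1) (\<mu> + 1) z)"
  proof (intro sums_add sums_diff sums_mult kummer_sums)
    show "(\<lambda>n. ?t (\<nu> + 1) (\<mu> + 1) (Suc n)) sums (kummer_Phi (\<nu> + 1) (\<mu> + 1) z - 1)"
      using kummer_sums[of "\<nu> + 1" "\<mu> + 1" z] by (subst sums_Suc_iff) simp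
  qed
  moreover have "(\<nu> + 1) / (\<mu> + 1) * z * ?t (\<nu> + 2) (\<mu> + 2) n + \<mu> * ?t (\<nu> + 1) (\<mu> + 1) (Suc n)
              - z * ?t (\<nu> + 1) (\<mu> + 1) n = \<mu> * ?t \<nu> \<mu> (Suc n)" for n
  proof -
    define p q where "p = pochhammer (\<nu> + 1) n" and "q = pochhammer (\<mu> + 1) n"
    have q: "q \<noteq> 0"
      using nz[of "Suc _"] by (auto simp: q_def pochhammer_eq_0_iff algebra_simps eq_neg_iff_add_eq_0)
    have e: "(\<nu> + 1) * pochhammer (\<nu> + 2) n = p * (\<nu> + 1 + of_nat n)"
            "(\<mu> + 1) * pochhammer (\<mu> + 2) n = q * (\<mu> + 1 + of_nat n)"
      using pochhammer_rec[of "\<nu> + 1" n] pochhammer_rec[of "\<mu> + 1" n]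
      by (simp_all add: p_def q_def pochhammer_Suc add.assoc)
    have "(\<nu> + 1) / (\<mu> + 1) * z * ?t (\<nu> + 2) (\<mu> + 2) n =
        ((\<nu> + 1) * pochhammer (\<nu> + 2) n) / ((\<mu> + 1) * pochhammer (\<mu> + 2) n) * (z ^ Suc n / fact n)"
      by (simp add: mult_ac)
    also have "\<dots> = p * (\<nu> + 1 + of_nat n) / (q * (\<mu> + 1 + of_nat n)) * (z ^ Suc n / fact n)"
      by (simp only: e)
    finally have 1: "(\<nu> + 1) / (\<mu> + 1) * z * ?t (\<nu> + 2) (\<mu> + 2) n =
      p * (\<nu> + 1 + of_nat n) / (q * (\<mu> + 1 + of_nat n)) * (z ^ Suc n / fact n)" .
    have 2: "?t (\<nu> + 1) (\<mu> + 1) (Suc n) =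
        p * (\<nu> + 1 + of_nat n) / (q * (\<mu> + 1 + of_nat n)) * (z ^ Suc n / fact n / (1 + of_nat n))"
      by (simp add: pochhammer_Suc p_def q_def)
    have 3: "?t \<nu> \<mu> (Suc n) = \<nu> * p / (\<mu> * q) * (z ^ Suc n / fact n / (1 + of_nat n))"
      by (simp add: pochhammer_rec p_def q_def)
    have 4: "z * ?t (\<nu> + 1) (\<mu> + 1) n = p / q * (z ^ Suc n / fact n)"
      by (simp add: p_def q_def)
    have "1 + of_nat n \<noteq> (0 :: complex)" by (metis of_nat_Suc of_nat_neq_0)
    moreover have "\<mu> + 1 + of_nat n \<noteq> 0" using nz[of "Suc n"] by (simp add: add_ac)
    moreover have "\<mu> \<noteq> 0" using nz[of 0] by simp
    ultimately have "p * (\<nu> + 1 + of_nat n) / (q * (\<mu> + 1 + of_nat n)) +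
       \<mu> * (p * (\<nu> + 1 + of_nat n) / (q * (\<mu> + 1 + of_nat n)) / (1 + of_nat n)) - p / q =
       \<mu> * (\<nu> * p / (\<mu> * q) / (1 + of_nat n))"
      using q by (simp add: divide_simps) algebra
    \<comment> \<open>Restores the common factor \<open>w\<close> = z^(n+1)/n!, with
      \<open>m\<close> = n + 1, to the rational identity just obtained.\<close>
    moreover have "A * w + \<mu> * (A * (w / m)) - C * w = \<mu> * (D * (w / m))"
      if "A + \<mu> * (A / m) - C = \<mu> * (D / m)" for A C D w m :: complex
    proof -
      have "A * w + \<mu> * (A * (w / m)) - C * w = (A + \<mu> * (A / m) - C) * w"
        by (simp add: algebra_simps)
      also have "\<dots> = \<mu> * (D * (w / m))"
        unfolding that by simp
      finally show ?thesis .
    qed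
    ultimately show ?thesis
      unfolding 1 2 3 4 by blast
  qed
  moreover have "(\<lambda>n. \<mu> * ?t \<nu> \<mu> (Suc n)) sums (\<mu> * (kummer_Phi \<nu> \<mu> z - 1))"
    using kummer_sums[of \<nu> \<mu> z] by (intro sums_mult) (subst sums_Suc_iff, simp)
  ultimately have "(\<nu> + 1) / (\<mu> + 1) * z * kummer_Phi (\<nu> + 2) (\<mu> + 2) z
          + \<mu> * (kummer_Phi (\<nu> + 1) (\<mu> + 1) z - 1) - z * kummer_Phi (\<nu> + 1) (\<mu> + 1) z
          = \<mu> * (kummer_Phi \<nu> \<mu> z - 1)"
    by (simp add: sums_iff)
  then show ?thesis by (simp add: algebra_simps)
qed

lemma holomorphic_on_parabolic_cylinder_D_param [holomorphic_intros]:
  assumes "f holomorphic_on A"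
  shows "(\<lambda>w. parabolic_cylinder_D (f w) z) holomorphic_on A"
  unfolding parabolic_cylinder_D_def by (intro holomorphic_intros assms) auto

subsection \<open>Growth on the imaginary axis\<close>

text \<open>
  With $A = \Phi' - \Phi$ and $B = \Phi'$ taken at $at$, Kummer's equation gives
  $dA/dt = W/t$ and $dB/dt = aB + W/t$ with $W = \nu\Phi - \mu\Phi'$. As $\Re a = 0$, the term $aB$ does not
  contribute to the derivative of $E = |A|^2 + |B|^2$, so $E' \le (4M/t) E$ with $M = R + |\mu|$.
\<close>

lemma kummer_Phi_imag_growth:
  fixes a \<nu> \<mu> :: complex and R t :: real
  assumes a: "Re a = 0" and mu: "\<mu> \<notin> \<int>\<^sub>\<le>\<^sub>0" and nu: "norm \<nu> \<le> R" and t: "t \<ge> 1"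
  defines "K \<equiv> kummer_majorant R \<mu> (norm a)"
    and "L \<equiv> R / norm \<mu> * kummer_majorant (R + 1) (\<mu> + 1) (norm a)"
  shows "norm (kummer_Phi \<nu> \<mu> (a * of_real t))
           \<le> sqrt (2 * ((K + L) ^ 2 + L ^ 2)) * t powr (2 * (R + norm \<mu>))"
proof -
  define M where "M = R + norm \<mu>"
  define f where "f = (\<lambda>t::real. kummer_Phi \<nu> \<mu> (a * of_real t))"
  \<comment> \<open>\<open>p\<close> is the derivative of \<Phi> in its complex argument, taken at
    at; the derivative of \<open>f\<close> in t is therefore ap.\<close>
  define p where "p = (\<lambda>t::real. \<nu> / \<mu> * kummer_Phi (\<nu> + 1) (\<mu> + 1) (a * of_real t))"
  define W where "W = (\<lambda>t. \<nu> * f t - \<mu> * p t)"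
  define E where "E = (\<lambda>t. (p t - f t) \<bullet> (p t - f t) + p t \<bullet> p t)"
  define E' where "E' = (\<lambda>t. 2 / t * ((p t - f t) \<bullet> W t + p t \<bullet> W t))"
  have [simp]: "\<mu> \<noteq> 0" using mu by auto
  have chain: "((\<lambda>t. kummer_Phi \<nu> \<mu> (a * of_real t)) has_vector_derivative
      a * (\<nu> / \<mu> * kummer_Phi (\<nu> + 1) (\<mu> + 1) (a * of_real t))) (at t)" for \<nu> \<mu> t
  proof -
    have "((\<lambda>t. a * of_real t) has_vector_derivative a * 1) (at t)"
      by (intro has_vector_derivative_mult_right) (auto intro!: derivative_eq_intros)
    from field_vector_diff_chain_at[OF this has_field_derivative_kummer_Phi]
    show ?thesis by (simp add: o_def)
  qed
  have df: "(f has_vector_derivative a * p t) (at t)" for t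
    unfolding f_def p_def by (rule chain)
  have dp: "(p has_vector_derivative a * p t + W t / of_real t) (at t)" if "t > 0" for t
  proof -
    have "(p has_vector_derivative \<nu> / \<mu> * (a * ((\<nu> + 1) / (\<mu> + 1) * kummer_Phi (\<nu> + 2) (\<mu> + 2) (a * of_real t)))) (at t)"
      unfolding p_def using chain[of "\<nu> + 1" "\<mu> + 1" t]
      by (intro has_vector_derivative_mult_right) (simp add: add.assoc)
    \<comment> \<open>Multiplying by t produces the coefficient z = at that Kummer's equation has in
      front of the second derivative.\<close>
    moreover have "of_real t * (\<nu> / \<mu> * (a * ((\<nu> + 1) / (\<mu> + 1) * kummer_Phi (\<nu> + 2) (\<mu> + 2) (a * of_real t)))) =
        of_real t * (a * p t + W t / of_real t)"
    proof -
      have "of_real t * (\<nu> / \<mu> * (a * ((\<nu> + 1) / (\<mu> + 1) * kummer_Phi (\<nu> + 2) (\<mu> + 2) (a * of_real t))))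
         = \<nu> / \<mu> * ((\<nu> + 1) / (\<mu> + 1) * (a * of_real t) * kummer_Phi (\<nu> + 2) (\<mu> + 2) (a * of_real t))"
        by (simp add: mult_ac)
      also have "\<dots> = \<nu> / \<mu> * (\<mu> * f t - (\<mu> - a * of_real t) * kummer_Phi (\<nu> + 1) (\<mu> + 1) (a * of_real t))"
        unfolding f_def kummer_contiguous[OF mu, of \<nu> "a * of_real t", symmetric] by simp
      also have "\<dots> = \<nu> * f t - \<mu> * p t + of_real t * a * p t"
        by (simp add: p_def field_simps)
      also have "\<dots> = of_real t * (a * p t + W t / of_real t)"
        using that by (simp add: W_def field_simps)
      finally show ?thesis .
    qed
    ultimately show ?thesis
      using that by (metis mult_left_cancel of_real_eq_0_iff less_irrefl)
  qed
  have dE: "(E has_real_derivative E' t) (at t)" if "t > 0" for t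
  proof -
    have A: "((\<lambda>t. p t - f t) has_vector_derivative W t / of_real t) (at t)"
      using has_vector_derivative_diff[OF dp[OF that] df] by simp
    \<comment> \<open>The real inner product of p and ap is Re a |p|^2: the only place where a must
      be imaginary.\<close>
    have "p t \<bullet> (a * p t) = 0"
      using a by (simp add: inner_complex_def algebra_simps)
    moreover have "W t / of_real t = (1 / t) *\<^sub>R W t"
      by (simp add: scaleR_conv_of_real)
    ultimately have "2 * ((p t - f t) \<bullet> (W t / of_real t)) + 2 * (p t \<bullet> (a * p t + W t / of_real t)) = E' t"
      by (simp only: inner_add_right inner_scaleR_right E'_def) (simp add: field_simps add_divide_distrib)
    moreover have "(E has_vector_derivative
       2 * ((p t - f t) \<bullet> (W t / of_real t)) + 2 * (p t \<bullet> (a * p t + W t / of_real t))) (at t)"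
      unfolding E_def
      using has_vector_derivative_add[OF bounded_bilinear.has_vector_derivative[OF bounded_bilinear_inner A A]
          bounded_bilinear.has_vector_derivative[OF bounded_bilinear_inner dp[OF that] dp[OF that]]]
      by (simp add: inner_commute)
    ultimately show ?thesis
      by (simp add: has_real_derivative_iff_has_vector_derivative)
  qed
  have "R \<ge> 0" using order_trans[OF norm_ge_zero nu] .
  then have "M \<ge> 0" by (simp add: M_def)
  have E'_le: "E' t \<le> 4 * M / t * E t" if "t > 0" for t
  proof -
    let ?A = "norm (p t - f t)" and ?B = "norm (p t)"
    have "norm (f t) \<le> ?A + ?B"
      using norm_triangle_ineq4[of "p t" "p t - f t"] by simp
    then have "norm (W t) \<le> R * (?A + ?B) + norm \<mu> * ?B"
      unfolding W_def using nu \<open>R \<ge> 0\<close>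
      by (intro order_trans[OF norm_triangle_ineq4] add_mono) (auto simp: norm_mult intro!: mult_mono)
    also have "\<dots> \<le> M * (?A + ?B)"
      by (simp add: M_def algebra_simps)
    finally have W: "norm (W t) \<le> M * (?A + ?B)" .
    have "(p t - f t) \<bullet> W t + p t \<bullet> W t \<le> ?A * norm (W t) + ?B * norm (W t)"
      by (intro add_mono norm_cauchy_schwarz)
    also have "\<dots> = (?A + ?B) * norm (W t)" by (simp add: algebra_simps)
    also have "\<dots> \<le> (?A + ?B) * (M * (?A + ?B))"
      by (intro mult_left_mono W) auto
    also have "\<dots> = M * (?A + ?B)\<^sup>2" by (simp add: power2_eq_square)
    also have "\<dots> \<le> M * (2 * E t)"
    proof -
      have "(?A + ?B)\<^sup>2 + (?A - ?B)\<^sup>2 = 2 * E t"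
        by (simp add: E_def dot_square_norm power2_eq_square algebra_simps)
      then have "(?A + ?B)\<^sup>2 \<le> 2 * E t"
        using zero_le_power2[of "?A - ?B"] by linarith
      then show ?thesis using \<open>M \<ge> 0\<close> by (rule mult_left_mono)
    qed
    finally have "E' t \<le> 2 / t * (M * (2 * E t))"
      unfolding E'_def using that by (intro mult_left_mono) auto
    then show ?thesis by (simp add: algebra_simps)
  qed
  \<comment> \<open>Gronwall's argument with integrating factor t^(-4M). Starting at t = 1 avoids
    the singularity of 1/t at the origin.\<close>
  have "E t * t powr (- (4 * M)) \<le> E 1 * 1 powr (- (4 * M))"
  proof (rule DERIV_nonpos_imp_nonincreasing[OF t])
    fix s :: real assume "1 \<le> s" "s \<le> t"
    then have s: "s > 0" by simp
    have "((\<lambda>s. E s * s powr (- (4 * M))) has_real_derivative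
        (E' s - 4 * M / s * E s) * s powr (- (4 * M))) (at s)"
      using s by (auto intro!: derivative_eq_intros dE simp: powr_diff field_simps)
    moreover have "(E' s - 4 * M / s * E s) * s powr (- (4 * M)) \<le> 0"
      using E'_le[OF s] by (intro mult_nonpos_nonneg) auto
    ultimately show "\<exists>y. ((\<lambda>s. E s * s powr (- (4 * M))) has_real_derivative y) (at s) \<and> y \<le> 0"
      by blast
  qed
  then have "E t \<le> E 1 * t powr (4 * M)"
    using t by (simp add: powr_minus field_simps)
  \<comment> \<open>At t = 1 the argument is a itself, so the majorants at radius |a| bound \<Phi>
    by \<open>K\<close> and its derivative by \<open>L\<close>.\<close>
  moreover have "E 1 \<le> (K + L)\<^sup>2 + L\<^sup>2"
  proof -
    have 1: "norm (f 1) \<le> K"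
      unfolding f_def K_def using nu by (intro norm_kummer_Phi_le) auto
    have "norm (\<nu> + 1) \<le> R + 1"
      using norm_triangle_ineq[of \<nu> 1] nu by simp
    then have "norm (kummer_Phi (\<nu> + 1) (\<mu> + 1) (a * of_real 1)) \<le> kummer_majorant (R + 1) (\<mu> + 1) (norm a)"
      by (intro norm_kummer_Phi_le) auto
    then have 2: "norm (p 1) \<le> L"
      unfolding p_def L_def norm_mult norm_divide using nu \<open>R \<ge> 0\<close>
      by (intro mult_mono divide_right_mono) auto
    have "norm (p 1 - f 1) \<le> K + L"
      using norm_triangle_ineq4[of "p 1" "f 1"] 1 2 by simp
    then show ?thesis
      using 2 unfolding E_def dot_square_norm by (intro add_mono power_mono) auto
  qed
  ultimately have E: "E t \<le> ((K + L)\<^sup>2 + L\<^sup>2) * t powr (4 * M)"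
    by (meson mult_right_mono order_trans powr_ge_zero)
  \<comment> \<open>Parallelogram law for p - f and p, whose difference is -f and whose sum is 2p -
    f. The square root taken afterwards halves the exponent 4M.\<close>
  have "(norm (f t))\<^sup>2 \<le> 2 * E t"
  proof -
    have "(norm (f t))\<^sup>2 + (norm (2 * p t - f t))\<^sup>2 = 2 * E t"
      unfolding E_def cmod_power2 inner_complex_def by (simp add: power2_eq_square algebra_simps)
    then show ?thesis using zero_le_power2[of "norm (2 * p t - f t)"] by linarith
  qed
  also have "\<dots> \<le> 2 * (((K + L)\<^sup>2 + L\<^sup>2) * t powr (4 * M))"
    using E by simp
  also have "\<dots> = (sqrt (2 * ((K + L)\<^sup>2 + L\<^sup>2)) * t powr (2 * M))\<^sup>2"
    by (simp add: power_mult_distrib power2_eq_square[of "_ powr _"] powr_add[symmetric] algebra_simps)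
  finally have "norm (f t) \<le> sqrt (2 * ((K + L)\<^sup>2 + L\<^sup>2)) * t powr (2 * M)"
    by (rule power2_le_imp_le) auto
  then show ?thesis by (simp add: f_def M_def)
qed

text \<open>This is y \<le> e^y at y = \<delta>x/M, raised to the power M. It trades polynomial
  growth for an exponential of arbitrarily small rate.\<close>

lemma powr_le_exp:
  fixes x M \<delta> :: real
  assumes "x > 0" "M > 0" "\<delta> > 0"
  shows "x powr M \<le> (M / \<delta>) powr M * exp (\<delta> * x)"
proof -
  have "\<delta> * x / M \<le> exp (\<delta> * x / M)"
    using exp_ge_add_one_self[of "\<delta> * x / M"] by linarith
  then have "x \<le> M / \<delta> * exp (\<delta> * x / M)"
    using assms by (simp add: field_simps)
  then have "x powr M \<le> (M / \<delta> * exp (\<delta> * x / M)) powr M"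
    using assms by (intro powr_mono2) auto
  also have "\<dots> = (M / \<delta>) powr M * exp (\<delta> * x)"
    using assms by (subst powr_mult) (auto simp: exp_powr_real)
  finally show ?thesis .
qed

lemma kummer_Phi_imag_bound:
  fixes a \<mu> :: complex and R \<delta> :: real
  assumes "Re a = 0" "\<mu> \<notin> \<int>\<^sub>\<le>\<^sub>0" "\<delta> > 0" "R \<ge> 0"
  obtains C where "C \<ge> 0"
    "\<And>\<nu> x. norm \<nu> \<le> R \<Longrightarrow> x > 0 \<Longrightarrow> norm (kummer_Phi \<nu> \<mu> (a * of_real x ^ 2)) \<le> C * exp (\<delta> * x)"
proof -
  define K where "K = kummer_majorant R \<mu> (norm a)"
  define L where "L = R / norm \<mu> * kummer_majorant (R + 1) (\<mu> + 1) (norm a)"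
  define B where "B = sqrt (2 * ((K + L) ^ 2 + L ^ 2))"
  \<comment> \<open>The growth exponent is 2(R + |\<mu>|) in t, and t = x^2 doubles it.\<close>
  define M where "M = 4 * (R + norm \<mu>)"
  have "\<mu> \<noteq> 0" using assms by auto
  then have "M > 0" using assms by (auto simp: M_def add_nonneg_pos)
  have K: "norm (kummer_Phi \<nu> \<mu> w) \<le> K" if "norm \<nu> \<le> R" "norm w \<le> norm a" for \<nu> w
    unfolding K_def using that by (intro norm_kummer_Phi_le)
  have "0 \<le> K" using K[of 0 0] assms order_trans[OF norm_ge_zero] by fastforce
  have "B \<ge> 0" by (simp add: B_def)
  show ?thesis
  proof
    show "0 \<le> K + B * (M / \<delta>) powr M" using \<open>0 \<le> K\<close> \<open>0 \<le> B\<close> by simp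
    fix \<nu> :: complex and x :: real
    assume nu: "norm \<nu> \<le> R" and x: "x > 0"
    have "norm (kummer_Phi \<nu> \<mu> (a * of_real x ^ 2)) \<le> K + B * x powr M"
    \<comment> \<open>The growth estimate starts at t = 1; for smaller x the argument stays in the
      disc of radius |a|, where the power series suffices.\<close>
    proof (cases "x \<le> 1")
      case True
      then have "norm (a * of_real x ^ 2) \<le> norm a"
        using x by (simp add: norm_mult norm_power mult_left_le power_le_one)
      then show ?thesis
        using K[OF nu] \<open>B \<ge> 0\<close> by (simp add: add_increasing2)
    next
      case False
      have "norm (kummer_Phi \<nu> \<mu> (a * of_real (x ^ 2))) \<le> B * (x ^ 2) powr (2 * (R + norm \<mu>))"
        using False nu assms unfolding B_def K_def L_def
        by (intro kummer_Phi_imag_growth) auto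
      also have "(x ^ 2) powr (2 * (R + norm \<mu>)) = x powr M"
        using x by (simp add: M_def powr_power powr_powr mult_ac flip: powr_numeral)
      finally show ?thesis using \<open>0 \<le> K\<close> by simp
    qed
    also have "\<dots> \<le> K * exp (\<delta> * x) + B * ((M / \<delta>) powr M * exp (\<delta> * x))"
      using x \<open>M > 0\<close> assms \<open>0 \<le> K\<close> \<open>0 \<le> B\<close>
      by (intro add_mono mult_left_mono powr_le_exp) (auto simp: mult_le_cancel_left1)
    also have "\<dots> = (K + B * (M / \<delta>) powr M) * exp (\<delta> * x)"
      by (simp add: algebra_simps)
    finally show "norm (kummer_Phi \<nu> \<mu> (a * of_real x ^ 2)) \<le> (K + B * (M / \<delta>) powr M) * exp (\<delta> * x)" .
  qed
qed

subsection \<open>The Laplace transform of a Gaussian\<close>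

lemma Re_pos_imp_not_nonpos_Ints: "Re p > 0 \<Longrightarrow> p \<notin> \<int>\<^sub>\<le>\<^sub>0"
  by (auto elim!: nonpos_Ints_cases)

lemma Gamma_integral_lborel:
  assumes "Re p > 0"
  shows "integrable (restrict_space lborel {0<..}) (\<lambda>t. of_real t powr (p - 1) * exp (- of_real t))"
    and "(\<integral>t. of_real t powr (p - 1) * exp (- of_real t) \<partial>restrict_space lborel {0<..}) = Gamma p"
proof -
  let ?f = "\<lambda>t::real. of_real t powr (p - 1) * exp (- of_real t) :: complex"
  show int: "integrable (restrict_space lborel {0<..}) ?f"
    using assms
    by (intro integrable_powr_exp_bound[of "Re p" 1 _ 1])
      (auto intro!: continuous_intros simp: norm_mult norm_powr_real_powr complex_nonpos_Reals_iff)
  have "(?f has_integral Gamma p) {0<..}"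
    using Gamma_integral_complex'[OF assms] by (simp add: exp_minus exp_of_real divide_inverse)
  then have "integral {0<..} ?f = Gamma p"
    by (rule integral_unique)
  then show "integral\<^sup>L (restrict_space lborel {0<..}) ?f = Gamma p"
    using set_borel_integral_eq_integral(2)[of "{0<..}" ?f] int
    by (simp add: set_integrable_iff_restrict_space set_lebesgue_integral_restrict_space)
qed

text \<open>Completing the square with b + 1 instead of b leaves a spare -s, so Gaussian integrands
  meet \<open>integrable_powr_exp_bound\<close> with rate 1.\<close>

lemma linear_minus_square_le:
  fixes a b s :: real
  assumes "a > 0"
  shows "b * s - a / 2 * s ^ 2 \<le> (b + 1) ^ 2 / (2 * a) - s"
proof -
  have "0 \<le> (a * s - (b + 1)) ^ 2 / (2 * a)" using assms by simp
  also have "\<dots> = a / 2 * s ^ 2 - (b + 1) * s + (b + 1) ^ 2 / (2 * a)"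
    using assms by (simp add: field_simps power2_eq_square)
  finally show ?thesis by (simp add: algebra_simps)
qed

lemma continuous_on_of_real_powr [continuous_intros]:
  "continuous_on {0<..} (\<lambda>s::real. of_real s powr p :: complex)"
  by (auto intro!: continuous_intros simp: complex_nonpos_Reals_iff)

text \<open>The substitution t = as^2/2 turns the Gamma integral for p/2 into this moment.\<close>

lemma gaussian_moment:
  fixes a :: real
  assumes p: "Re p > 0" and a: "a > 0"
  shows "(\<integral>s. of_real s powr (p - 1) * exp (- 1 / 2 * of_real a * of_real s ^ 2) \<partial>restrict_space lborel {0<..})
     = 1 / 2 * of_real (2 / a) powr (p / 2) * Gamma (p / 2)"
proof -
  let ?f = "\<lambda>t::real. of_real t powr (p / 2 - 1) * exp (- of_real t) :: complex"
  let ?h = "\<lambda>s::real. of_real s powr (p - 1) * exp (- 1 / 2 * of_real a * of_real s ^ 2) :: complex"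
  let ?c = "2 * of_real (a / 2) powr (p / 2) :: complex"
  have int: "integrable (restrict_space lborel {0<..}) ?h"
  proof (rule integrable_powr_exp_bound[of "Re p" 1 _ "exp (1 / (2 * a))"])
    fix s :: real assume s: "s > 0"
    have "exp (- (a / 2 * s ^ 2)) \<le> exp (1 / (2 * a)) * exp (- s)"
      using linear_minus_square_le[OF a, of 0 s] by (simp flip: exp_add)
    then have "s powr (Re p - 1) * exp (- (a / 2 * s ^ 2)) \<le> s powr (Re p - 1) * (exp (1 / (2 * a)) * exp (- s))"
      by (rule mult_left_mono) simp
    then show "norm (?h s) \<le> exp (1 / (2 * a)) * (s powr (Re p - 1) * exp (- 1 * s))"
      using s by (simp add: norm_mult norm_powr_real_powr mult_ac)
  qed (use p in \<open>auto intro!: continuous_intros\<close>)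
  \<comment> \<open>The power t^(p/2 - 1) contributes s^(p - 2), and the Jacobian as raises it to
    s^(p - 1).\<close>
  have eq: "(a * s) *\<^sub>R ?f (a / 2 * s ^ 2) = ?c * ?h s" if "s > 0" for s
  proof -
    have "of_real (a / 2 * s ^ 2) powr (p / 2 - 1) = of_real (a / 2) powr (p / 2 - 1) * of_real (s ^ 2) powr (p / 2 - 1)"
      using a that by (simp only: of_real_mult) (intro powr_times_real, auto)
    also have "complex_of_real (s ^ 2) powr (p / 2 - 1) = of_real s powr (p - 2)"
      using that by (simp add: powr_def Ln_of_real ln_realpow algebra_simps diff_divide_distrib del: of_real_power)
    also have "of_real s powr (p - 2) = of_real s powr (p - 1) / of_real s"
      using powr_diff[of "of_real s" "p - 1" 1] that by simp
    also have "of_real (a / 2) powr (p / 2 - 1) = of_real (a / 2) powr (p / 2) / of_real (a / 2)"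
      using powr_diff[of "of_real (a / 2)" "p / 2" 1] a by simp
    finally show ?thesis
      using a that by (simp add: scaleR_conv_of_real field_simps)
  qed
  have E: "einterval 0 \<infinity> = {0::real<..}" by (auto simp: einterval_def)
  have "(LBINT t=0..\<infinity>. ?f t) = (LBINT s=0..\<infinity>. (a * s) *\<^sub>R ?f (a / 2 * s ^ 2))"
  proof (rule interval_integral_substitution_integrable)
    show "((\<lambda>x. a / 2 * x ^ 2) has_real_derivative a * x) (at x)" for x
      by (auto intro!: derivative_eq_intros)
    show "isCont ?f (a / 2 * x ^ 2)" if "0 < ereal x" for x
    proof -
      have "a / 2 * x ^ 2 \<in> {0<..}" using that a by simp
      moreover have "continuous_on {0<..} ?f" by (auto intro!: continuous_intros)
      ultimately show ?thesis
        using continuous_on_eq_continuous_at open_greaterThan by blast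
    qed
    show "((ereal \<circ> (\<lambda>x. a / 2 * x ^ 2) \<circ> real_of_ereal) \<longlongrightarrow> 0) (at_right 0)"
      unfolding zero_ereal_def ereal_tendsto_simps
      by (auto intro!: tendsto_eq_intros)
    show "((ereal \<circ> (\<lambda>x. a / 2 * x ^ 2) \<circ> real_of_ereal) \<longlongrightarrow> \<infinity>) (at_left \<infinity>)"
      unfolding ereal_tendsto_simps tendsto_PInfty_eq_at_top
      using a by (intro filterlim_tendsto_pos_mult_at_top[OF tendsto_const] filterlim_pow_at_top filterlim_ident) auto
    show "set_integrable lborel (einterval 0 \<infinity>) (\<lambda>x. (a * x) *\<^sub>R ?f (a / 2 * x ^ 2))"
      unfolding E
    proof (subst set_integrable_cong[OF refl refl])
      show "(a * x) *\<^sub>R ?f (a / 2 * x ^ 2) = ?c * ?h x" if "x \<in> {0<..}" for x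
        using that by (intro eq) auto
      show "set_integrable lborel {0<..} (\<lambda>x. ?c * ?h x)"
        using int by (subst set_integrable_iff_restrict_space) auto
    qed
    show "set_integrable lborel (einterval 0 \<infinity>) ?f"
      unfolding E using Gamma_integral_lborel(1)[of "p / 2"] p
      by (subst set_integrable_iff_restrict_space) auto
  qed (use a in auto)
  then have "(LINT t:{0<..}|lborel. ?f t) = (LINT s:{0<..}|lborel. (a * s) *\<^sub>R ?f (a / 2 * s ^ 2))"
    by (simp add: interval_lebesgue_integral_def E)
  also have "\<dots> = (LINT s:{0<..}|lborel. ?c * ?h s)"
    by (intro set_lebesgue_integral_cong allI impI eq) auto
  finally have "Gamma (p / 2) = ?c * integral\<^sup>L (restrict_space lborel {0<..}) ?h"
    using Gamma_integral_lborel(2)[of "p / 2"] p int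
    by (simp add: set_lebesgue_integral_restrict_space)
  moreover have "of_real (2 / a) powr (p / 2) * of_real (a / 2) powr (p / 2) = (1 :: complex)"
    using a powr_times_real[of "of_real (2 / a)" "of_real (a / 2)" "p / 2"]
    by simp
  ultimately show ?thesis
    by (simp add: algebra_simps)
qed

lemma sums_even_plus_odd:
  fixes f :: "nat \<Rightarrow> 'a::real_normed_vector"
  assumes "f sums s" "(\<lambda>k. f (2 * k)) sums e" "(\<lambda>k. f (2 * k + 1)) sums d"
  shows "s = e + d"
proof -
  have "(\<lambda>k. f (2 * k) + f (2 * k + 1)) sums s"
    using sums_group[OF assms(1), of 2] by (simp add: mult.commute)
  then show ?thesis
    using sums_add[OF assms(2,3)] sums_unique2 by blast
qed

text \<open>The n-th term of e^{-zs} leads to the moment with p = \<nu> + n. Even and odd n give the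
  two Kummer series, because (2k)! = 4^k (1/2)_k k! and (2k+1)! = 4^k (3/2)_k k!.\<close>

lemma gaussian_laplace_expansion:
  fixes a :: real and z \<nu> :: complex
  assumes nu: "Re \<nu> > 0" and a: "a > 0"
  shows "(\<integral>s. of_real s powr (\<nu> - 1) * exp (- z * of_real s - 1 / 2 * of_real a * of_real s ^ 2) \<partial>restrict_space lborel {0<..})
     = 1 / 2 * of_real (2 / a) powr (\<nu> / 2) * Gamma (\<nu> / 2) * kummer_Phi (\<nu> / 2) (1 / 2) (z ^ 2 / (2 * of_real a))
     - z / 2 * of_real (2 / a) powr (\<nu> / 2 + 1 / 2) * Gamma (\<nu> / 2 + 1 / 2) *
         kummer_Phi (\<nu> / 2 + 1 / 2) (3 / 2) (z ^ 2 / (2 * of_real a))"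
    (is "?I = ?E - ?O")
proof -
  let ?M = "restrict_space lborel {0::real<..}"
  let ?b = "complex_of_real (2 / a)" and ?w = "z ^ 2 / (2 * of_real a)"
  define g where "g = (\<lambda>s::real. of_real s powr (\<nu> - 1) * exp (- 1 / 2 * of_real a * of_real s ^ 2) :: complex)"
  define c where "c = (\<lambda>n. (- z) ^ n / fact n * (1 / 2 * ?b powr ((\<nu> + of_nat n) / 2) * Gamma ((\<nu> + of_nat n) / 2)))"
  have "(\<lambda>n. \<integral>s. g s * (- z * of_real s) ^ n / fact n \<partial>?M) sums (\<integral>s. g s * exp (- z * of_real s) \<partial>?M)"
  proof (rule sums_integral_exp)
    show "g \<in> borel_measurable ?M" "(\<lambda>s. - z * of_real s) \<in> borel_measurable ?M"
      unfolding g_def by (intro borel_measurable_restrict_lborel continuous_intros)+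
    \<comment> \<open>Here a > 0 matters: the Gaussian beats e^{|z|s}, by
      \<open>linear_minus_square_le\<close> with b = |z|.\<close>
    have "integrable ?M (\<lambda>s. g s * of_real (exp (norm z * s)))"
    proof (rule integrable_powr_exp_bound[of "Re \<nu>" 1 _ "exp ((norm z + 1) ^ 2 / (2 * a))"])
      fix s :: real assume s: "s > 0"
      have "exp (norm z * s - a / 2 * s ^ 2) \<le> exp ((norm z + 1) ^ 2 / (2 * a)) * exp (- s)"
        using linear_minus_square_le[OF a, of "norm z" s] by (simp flip: exp_add)
      then have "s powr (Re \<nu> - 1) * exp (norm z * s - a / 2 * s ^ 2)
          \<le> s powr (Re \<nu> - 1) * (exp ((norm z + 1) ^ 2 / (2 * a)) * exp (- s))"
        by (rule mult_left_mono) simp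
      moreover have "exp (norm z * s - a / 2 * s ^ 2) = exp (norm z * s) * exp (- (a / 2 * s ^ 2))"
        by (simp flip: exp_add)
      moreover have "norm (g s * of_real (exp (norm z * s)))
          = s powr (Re \<nu> - 1) * (exp (norm z * s) * exp (- (a / 2 * s ^ 2)))"
        using s by (simp add: g_def norm_mult norm_powr_real_powr mult_ac)
      ultimately show "norm (g s * of_real (exp (norm z * s))) \<le> exp ((norm z + 1) ^ 2 / (2 * a)) * (s powr (Re \<nu> - 1) * exp (- 1 * s))"
        by (simp add: mult_ac)
    qed (use nu in \<open>auto intro!: continuous_intros simp: g_def\<close>)
    from integrable_norm[OF this]
    have "integrable ?M (\<lambda>s. norm (g s) * exp (norm z * s))"
      by (simp add: norm_mult)
    then show "integrable ?M (\<lambda>s. norm (g s) * exp (norm (- z * of_real s)))"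
      by (rule Bochner_Integration.integrable_cong[THEN iffD1, rotated 2]) (auto simp: space_restrict_space norm_mult)
  qed
  also have "(\<lambda>n. \<integral>s. g s * (- z * of_real s) ^ n / fact n \<partial>?M) = c"
  proof
    fix n
    have "(\<integral>s. g s * (- z * of_real s) ^ n / fact n \<partial>?M) =
      (\<integral>s. (- z) ^ n / fact n * (of_real s powr (\<nu> + of_nat n - 1) * exp (- 1 / 2 * of_real a * of_real s ^ 2)) \<partial>?M)"
    proof (rule Bochner_Integration.integral_cong[OF refl])
      fix s assume "s \<in> space ?M"
      then have "of_real s powr (\<nu> + of_nat n - 1) = of_real s powr (\<nu> - 1) * complex_of_real s ^ n"
        using powr_add[of "of_real s" "\<nu> - 1" "of_nat n"]
        by (simp add: space_restrict_space powr_nat algebra_simps)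
      then show "g s * (- z * of_real s) ^ n / fact n =
         (- z) ^ n / fact n * (of_real s powr (\<nu> + of_nat n - 1) * exp (- 1 / 2 * of_real a * of_real s ^ 2))"
        by (simp only: g_def power_mult_distrib) simp
    qed
    also have "\<dots> = c n"
    proof -
      have "Re (\<nu> + of_nat n) > 0" using nu by simp
      from gaussian_moment[OF this a] show ?thesis
        unfolding c_def integral_mult_right_zero by (rule arg_cong)
    qed
    finally show "(\<integral>s. g s * (- z * of_real s) ^ n / fact n \<partial>?M) = c n" .
  qed
  also have "(\<integral>s. g s * exp (- z * of_real s) \<partial>?M) = ?I"
    unfolding g_def mult.assoc exp_add[symmetric] by (simp add: algebra_simps)
  finally have sums: "c sums ?I" .
  have Gamma: "Gamma (p + of_nat k) = Gamma p * pochhammer p k" if "Re p > 0" for p :: complex and k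
    using Re_pos_imp_not_nonpos_Ints[OF that] by (simp add: pochhammer_Gamma Gamma_eq_zero_iff)
  have powr: "?b powr (p + of_nat k) = ?b powr p * (2 / of_real a) ^ k" for p k
    using a by (simp add: powr_add powr_nat)
  have even_powers: "(- z) ^ (2 * k) = (z ^ 2) ^ k" "(2::complex) ^ (2 * k) = 2 ^ k * 2 ^ k" for k
    using power_mult[of "- z" 2 k] power_add[of "2 :: complex" k k] by (simp_all flip: mult_2)
  have "(\<lambda>k. c (2 * k)) sums ?E"
  proof -
    have "c (2 * k) = 1 / 2 * ?b powr (\<nu> / 2) * Gamma (\<nu> / 2) * (pochhammer (\<nu> / 2) k / pochhammer (1 / 2) k * (?w ^ k / fact k))" for k
    proof -
      have half: "(\<nu> + of_nat (2 * k)) / 2 = \<nu> / 2 + of_nat k" by simp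
      show ?thesis
        using a nu unfolding c_def half powr Gamma[of "\<nu> / 2", simplified, OF nu] fact_double even_powers
        by (simp add: power_mult power_divide power_mult_distrib field_simps)
    qed
    then show ?thesis
      using sums_mult[OF kummer_sums[of "\<nu> / 2" "1 / 2" ?w], of "1 / 2 * ?b powr (\<nu> / 2) * Gamma (\<nu> / 2)"]
      by (simp only:)
  qed
  moreover have "(\<lambda>k. c (2 * k + 1)) sums (- ?O)"
  proof -
    have "c (2 * k + 1) = - (z / 2 * ?b powr (\<nu> / 2 + 1 / 2) * Gamma (\<nu> / 2 + 1 / 2)) *
        (pochhammer (\<nu> / 2 + 1 / 2) k / pochhammer (3 / 2) k * (?w ^ k / fact k))" for k
    proof -
      have half: "(\<nu> + of_nat (2 * k + 1)) / 2 = (\<nu> / 2 + 1 / 2) + of_nat k" by (simp add: field_simps)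
      have "(1 / 2) * pochhammer (3 / 2) k = pochhammer (1 / 2) k * (1 / 2 + of_nat k :: complex)"
        using pochhammer_rec[of "1 / 2 :: complex" k] by (simp add: pochhammer_Suc)
      then have "fact (2 * k + 1) = (2 ^ (2 * k) * pochhammer (3 / 2) k * fact k :: complex)"
        using fact_double[of k, where 'a = complex] by (simp add: algebra_simps)
      then show ?thesis
        using a nu unfolding c_def half powr power_add even_powers
        by (subst Gamma) (auto simp: power_mult power_divide power_mult_distrib field_simps)
    qed
    then show ?thesis
      using sums_mult[OF kummer_sums[of "\<nu> / 2 + 1 / 2" "3 / 2" ?w], of "- (z / 2 * ?b powr (\<nu> / 2 + 1 / 2) * Gamma (\<nu> / 2 + 1 / 2))"]
      by (simp only: mult_minus_left)
  qed
  ultimately have "?I = ?E + - ?O"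
    by (rule sums_even_plus_odd[OF sums])
  then show ?thesis by simp
qed

text \<open>With principal branches this is holomorphic in a off the closed negative real axis, a
  region that contains the right half-plane and the imaginary axis without 0.\<close>

definition gaussian_laplace_rhs :: "complex \<Rightarrow> complex \<Rightarrow> complex \<Rightarrow> complex" where
  "gaussian_laplace_rhs \<nu> z a =
     Gamma \<nu> * a powr (- \<nu> / 2) * exp (z ^ 2 / (4 * a)) * parabolic_cylinder_D (- \<nu>) (z / csqrt a)"

text \<open>Legendre's duplication formula rewrites \<Gamma>(\<nu>) through \<Gamma>(\<nu>/2)
  \<Gamma>(\<nu>/2 + 1/2); each reciprocal Gamma factor in D then cancels one of the two. Powers are
  written as exponentials in ln a and ln 2, so that matching them is linear algebra in the
  exponents.\<close>

lemma gaussian_laplace_pos_real: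
  fixes a :: real and z \<nu> :: complex
  assumes nu: "Re \<nu> > 0" and a: "a > 0"
  shows "(\<integral>s. of_real s powr (\<nu> - 1) * exp (- z * of_real s - 1 / 2 * of_real a * of_real s ^ 2) \<partial>restrict_space lborel {0<..})
    = gaussian_laplace_rhs \<nu> z (of_real a)"
proof -
  define A where "A = complex_of_real (ln a)"
  define B where "B = complex_of_real (ln 2)"
  define G0 G1 P where "G0 = Gamma (\<nu> / 2)" and "G1 = Gamma (\<nu> / 2 + 1 / 2)" and "P = complex_of_real (sqrt pi)"
  have nz: "G0 \<noteq> 0" "G1 \<noteq> 0" "P \<noteq> 0"
    using nu by (simp_all add: Re_pos_imp_not_nonpos_Ints G0_def G1_def P_def Gamma_eq_zero_iff)
  have dup: "G0 * G1 = exp ((1 - \<nu>) * B) * P * Gamma \<nu>"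
    using Gamma_legendre_duplication[of "\<nu> / 2"] nu
    by (simp add: Re_pos_imp_not_nonpos_Ints G0_def G1_def P_def B_def)
  have Gam: "Gamma \<nu> = exp ((\<nu> - 1) * B) * G0 * G1 / P"
  proof -
    have "exp ((\<nu> - 1) * B) * exp ((1 - \<nu>) * B) = 1"
      by (simp add: algebra_simps flip: exp_add)
    then show ?thesis
      using nz dup by (simp add: mult.assoc)
  qed
  have sqrt: "csqrt (of_real a) = exp (A / 2)"
    using a by (simp add: A_def csqrt_of_real_nonneg flip: powr_half_sqrt) (simp add: powr_def flip: exp_of_real)
  have sqrt2: "complex_of_real (sqrt (2 * pi)) = exp (B / 2) * P"
    by (simp add: B_def P_def real_sqrt_mult flip: powr_half_sqrt) (simp add: powr_def flip: exp_of_real)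
  have w: "(z / csqrt (of_real a)) ^ 2 = z ^ 2 / of_real a"
    by (simp add: power_divide)
  have powr: "of_real (2 / a) powr p = exp (p * (B - A))" "2 powr p = exp (p * B)" "of_real a powr p = exp (p * A)" for p
  proof -
    have "Ln (of_real (2 / a)) = B - A" "Ln 2 = B" "Ln (of_real a) = A"
      using a Ln_of_real[of "2 / a"] Ln_of_real[of 2] Ln_of_real[of a]
      by (simp_all add: A_def B_def ln_div del: of_real_divide)
    then show "of_real (2 / a) powr p = exp (p * (B - A))" "2 powr p = exp (p * B)" "of_real a powr p = exp (p * A)" for p
      using a by (simp_all add: powr_def del: of_real_divide)
  qed
  have half: "1 / 2 - (- \<nu>) / 2 = \<nu> / 2 + 1 / 2" "- (- \<nu>) / 2 = \<nu> / 2"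
    "z ^ 2 / of_real a / 2 = z ^ 2 / (2 * of_real a)"
    by simp_all
  have rG: "rGamma (\<nu> / 2 + 1 / 2) = 1 / G1" "rGamma (\<nu> / 2) = 1 / G0"
    by (simp_all only: G0_def G1_def rGamma_inverse_Gamma divide_inverse mult_1_left)
  have alg: "G * p * e * (t * e' * X) = G * p * t * X" if "e * e' = 1" for G p e t e' X :: complex
    using that by (metis (no_types, opaque_lifting) mult.assoc mult.commute mult_1_right)
  \<comment> \<open>The Gaussian prefactor of D at z/sqrt a cancels against the exponential in
    \<open>gaussian_laplace_rhs\<close>.\<close>
  have "exp (z\<^sup>2 / (4 * of_real a)) * exp (- (z ^ 2 / of_real a) / 4) = 1"
    unfolding exp_add[symmetric] by simp
  then have "gaussian_laplace_rhs \<nu> z (of_real a) =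
      Gamma \<nu> * of_real a powr (- \<nu> / 2) * 2 powr (- \<nu> / 2) *
       (P * (1 / G1) * kummer_Phi (\<nu> / 2) (1 / 2) (z ^ 2 / (2 * of_real a))
        - exp (B / 2) * P * (z / exp (A / 2)) * (1 / G0) * kummer_Phi (\<nu> / 2 + 1 / 2) (3 / 2) (z ^ 2 / (2 * of_real a)))"
    unfolding gaussian_laplace_rhs_def parabolic_cylinder_D_def w
    unfolding half rG sqrt2 sqrt P_def[symmetric] by (rule alg)
  also have "\<dots> = 1 / 2 * of_real (2 / a) powr (\<nu> / 2) * G0 * kummer_Phi (\<nu> / 2) (1 / 2) (z ^ 2 / (2 * of_real a))
     - z / 2 * of_real (2 / a) powr (\<nu> / 2 + 1 / 2) * G1 *
         kummer_Phi (\<nu> / 2 + 1 / 2) (3 / 2) (z ^ 2 / (2 * of_real a))"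
  proof -
    have B2: "exp (- B) = 1 / 2"
      by (simp add: B_def exp_minus exp_of_real)
    have e1: "exp ((\<nu> - 1) * B) * exp (- \<nu> / 2 * A) * exp (- \<nu> / 2 * B) = 1 / 2 * exp (\<nu> / 2 * (B - A))"
      unfolding B2[symmetric] by (simp add: algebra_simps diff_divide_distrib add_divide_distrib flip: exp_add)
    have e2: "1 / 2 * exp (\<nu> / 2 * (B - A)) * (exp (B / 2) / exp (A / 2)) = 1 / 2 * exp ((\<nu> / 2 + 1 / 2) * (B - A))"
      by (simp add: algebra_simps diff_divide_distrib add_divide_distrib flip: exp_add exp_diff)
    have "Gamma \<nu> * of_real a powr (- \<nu> / 2) * 2 powr (- \<nu> / 2) =
        (exp ((\<nu> - 1) * B) * exp (- \<nu> / 2 * A) * exp (- \<nu> / 2 * B)) * (G0 * G1 / P)"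
      unfolding powr Gam by simp
    then have e3: "Gamma \<nu> * of_real a powr (- \<nu> / 2) * 2 powr (- \<nu> / 2) =
        1 / 2 * exp (\<nu> / 2 * (B - A)) * (G0 * G1 / P)"
      unfolding e1 .
    have alg': "E * (G0 * G1 / P) * (P * (1 / G1) * X - b * P * (z / c) * (1 / G0) * Y)
       = E * G0 * X - z * (E * (b / c)) * G1 * Y" if "c \<noteq> 0" for E X Y b c
      using nz that by (simp add: field_simps)
    show ?thesis
      unfolding e3 unfolding alg'[OF exp_not_eq_zero] e2 unfolding powr by simp
  qed
  finally show ?thesis
    unfolding gaussian_laplace_expansion[OF nu a] G0_def G1_def by simp
qed

section \<open>Continuation of the Laplace transform in a\<close>

lemma holomorphic_on_gaussian_laplace_rhs:
  "gaussian_laplace_rhs \<nu> z holomorphic_on - \<real>\<^sub>\<le>\<^sub>0"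
proof -
  have "csqrt a \<noteq> 0" "a \<noteq> 0" if "a \<in> - \<real>\<^sub>\<le>\<^sub>0" for a
    using that by auto
  then show ?thesis
    unfolding gaussian_laplace_rhs_def parabolic_cylinder_D_def
    by (intro holomorphic_intros) auto
qed

text \<open>For Re a \<ge> 0 the Gaussian has modulus at most 1, so the bound \<open>g\<close>,
  whose decay comes from Re z > 0, does not involve a. It serves both for holomorphy in the open
  half-plane and for the passage to its boundary.\<close>

lemma gaussian_laplace:
  fixes a z \<nu> :: complex
  assumes nu: "Re \<nu> > 0" and z: "Re z > 0" and a: "Re a \<ge> 0" "a \<noteq> 0"
  shows "(\<integral>s. of_real s powr (\<nu> - 1) * exp (- z * of_real s - 1 / 2 * a * of_real s ^ 2) \<partial>restrict_space lborel {0<..})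
    = gaussian_laplace_rhs \<nu> z a"
proof -
  let ?M = "restrict_space lborel {0::real<..}"
  define f where "f = (\<lambda>a s. of_real s powr (\<nu> - 1) * exp (- z * of_real s - 1 / 2 * a * of_real s ^ 2))"
  define F where "F = (\<lambda>a. \<integral>s. f a s \<partial>?M)"
  define g where "g = (\<lambda>s. s powr (Re \<nu> - 1) * exp (- Re z * s))"
  have meas: "f a \<in> borel_measurable ?M" for a
    unfolding f_def by (intro borel_measurable_restrict_lborel continuous_intros)
  have int_g: "integrable ?M g"
    unfolding g_def using nu z by (rule powr_exp_integrable)
  have fg: "norm (f a s) \<le> g s" if "Re a \<ge> 0" "s > 0" for a s
    using that by (simp add: f_def g_def norm_mult norm_powr_real_powr mult_left_mono flip: of_real_power)
  have hol: "F holomorphic_on {a. Re a > 0}"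
    unfolding F_def
  proof (rule holomorphic_on_lebesgue_integral)
    show "(\<lambda>a. f a s) holomorphic_on {a. Re a > 0}" for s
      unfolding f_def by (intro holomorphic_intros)
    fix w assume w: "w \<in> {a. Re a > 0}"
    have pos: "Re u > 0" if "dist w u * 2 \<le> Re w" for u
      using abs_Re_le_cmod[of "w - u"] that w by (auto simp: dist_norm)
    show "\<exists>r>0. \<exists>g. cball w r \<subseteq> {a. 0 < Re a} \<and> integrable ?M g \<and>
       (\<forall>u\<in>cball w r. \<forall>x\<in>space ?M. norm (f u x) \<le> g x)"
      using w by (intro exI[of _ "Re w / 2"] exI[of _ g] conjI int_g ballI fg)
        (auto simp: space_restrict_space intro: less_imp_le pos)
  qed (auto intro: meas open_halfspace_Re_gt)
  have eq: "F b = gaussian_laplace_rhs \<nu> z b" if "Re b > 0" for b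
  proof -
    have sub: "{a. Re a > 0} \<subseteq> - \<real>\<^sub>\<le>\<^sub>0"
      by (auto simp: complex_nonpos_Reals_iff)
    have "F b - gaussian_laplace_rhs \<nu> z b = 0"
    proof (rule analytic_continuation[where f = "\<lambda>a. F a - gaussian_laplace_rhs \<nu> z a"])
      show "(\<lambda>a. F a - gaussian_laplace_rhs \<nu> z a) holomorphic_on {a. Re a > 0}"
        by (intro holomorphic_on_diff hol holomorphic_on_subset[OF holomorphic_on_gaussian_laplace_rhs sub])
      show "connected {a. Re a > 0}"
        by (simp add: convex_connected convex_halfspace_Re_gt)
      show "1 islimpt (of_real ` {0<..} :: complex set)"
        unfolding islimpt_approachable
      proof (intro allI impI)
        fix e :: real assume "e > 0"
        then show "\<exists>x'\<in>of_real ` {0<..}. x' \<noteq> (1 :: complex) \<and> dist x' 1 < e"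
          by (intro bexI[of _ "of_real (1 + e / 2)"] conjI imageI) (auto simp: dist_norm)
      qed
      show "F a - gaussian_laplace_rhs \<nu> z a = 0" if "a \<in> of_real ` {0<..}" for a :: complex
        using that gaussian_laplace_pos_real[OF nu] by (auto simp: F_def f_def)
    qed (use that in \<open>auto intro: open_halfspace_Re_gt\<close>)
    then show ?thesis by simp
  qed
  \<comment> \<open>The points a + 1/(n+1) approach a from inside the open half-plane, where the
    formula is already known.\<close>
  have X: "(\<lambda>n. a + of_real (1 / real (Suc n))) \<longlonglongrightarrow> a"
    using tendsto_add[OF tendsto_const tendsto_of_real[OF lim_inverse_n'[THEN LIMSEQ_Suc]], of a] by simp
  have "(\<lambda>n. F (a + of_real (1 / real (Suc n)))) \<longlonglongrightarrow> F a"
    unfolding F_def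
  proof (rule integral_dominated_convergence[OF _ _ int_g])
    show "AE s in ?M. (\<lambda>n. f (a + of_real (1 / real (Suc n))) s) \<longlonglongrightarrow> f a s"
      unfolding f_def by (intro AE_I2 tendsto_intros X)
    show "AE s in ?M. norm (f (a + of_real (1 / real (Suc n))) s) \<le> g s" for n
      using a by (intro AE_I2 fg) (auto simp: space_restrict_space)
  qed (auto intro: meas)
  moreover have "(\<lambda>n. F (a + of_real (1 / real (Suc n)))) = (\<lambda>n. gaussian_laplace_rhs \<nu> z (a + of_real (1 / real (Suc n))))"
    using a by (intro ext eq) (simp add: add_nonneg_pos)
  moreover have "(\<lambda>n. gaussian_laplace_rhs \<nu> z (a + of_real (1 / real (Suc n)))) \<longlonglongrightarrow> gaussian_laplace_rhs \<nu> z a"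
  proof -
    \<comment> \<open>The closed right half-plane meets the branch cut only at 0.\<close>
    have "a \<in> - \<real>\<^sub>\<le>\<^sub>0"
      using a by (auto simp: complex_nonpos_Reals_iff complex_eq_iff)
    then have "isCont (gaussian_laplace_rhs \<nu> z) a"
      using holomorphic_on_imp_continuous_on[OF holomorphic_on_gaussian_laplace_rhs]
      by (auto simp: continuous_on_eq_continuous_at open_Compl)
    then show ?thesis
      using X by (rule isCont_tendsto_compose)
  qed
  ultimately have "F a = gaussian_laplace_rhs \<nu> z a"
    by (metis LIMSEQ_unique)
  then show ?thesis by (simp add: F_def f_def)
qed

subsection \<open>The product of two Laplace transforms\<close>

text \<open>Fubini and translation invariance. On the whole line, extension by zero encodes the
  region 0 < s < x, so no limits of integration have to be tracked.\<close>

lemma lborel_integral_mult_convolution: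
  fixes P Q :: "real \<Rightarrow> complex"
  assumes P: "integrable lborel P" and Q: "integrable lborel Q"
  shows "integral\<^sup>L lborel P * integral\<^sup>L lborel Q = (\<integral>x. (\<integral>s. P s * Q (x - s) \<partial>lborel) \<partial>lborel)"
proof -
  have [measurable]: "P \<in> borel_measurable borel" "Q \<in> borel_measurable borel"
    using P Q by auto
  have shift: "integrable lborel (\<lambda>x. Q (x - s))" "(\<integral>x. Q (x - s) \<partial>lborel) = integral\<^sup>L lborel Q"
    "(\<integral>x. norm (Q (x - s)) \<partial>lborel) = (\<integral>x. norm (Q x) \<partial>lborel)" for s
    using lborel_integrable_real_affine[OF Q, of 1 "- s"]
      lborel_integral_real_affine[of 1 Q "- s"] lborel_integral_real_affine[of 1 "\<lambda>x. norm (Q x)" "- s"]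
    by simp_all
  have "integral\<^sup>L lborel P * integral\<^sup>L lborel Q = (\<integral>s. (\<integral>x. P s * Q (x - s) \<partial>lborel) \<partial>lborel)"
    by (simp add: shift)
  also have "\<dots> = (\<integral>x. (\<integral>s. P s * Q (x - s) \<partial>lborel) \<partial>lborel)"
  proof (rule lborel_pair.Fubini_integral[symmetric], rule lborel_pair.Fubini_integrable)
    show "(\<lambda>(s, x). P s * Q (x - s)) \<in> borel_measurable (lborel \<Otimes>\<^sub>M lborel)"
      by measurable
    show "integrable lborel (\<lambda>s. \<integral>x. norm (case (s, x) of (s, x) \<Rightarrow> P s * Q (x - s)) \<partial>lborel)"
      using P by (simp add: norm_mult shift)
    show "AE s in lborel. integrable lborel (\<lambda>x. case (s, x) of (s, x) \<Rightarrow> P s * Q (x - s))"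
      using shift by simp
  qed
  finally show ?thesis .
qed

text \<open>Euler's integral for \<Phi>(\<nu>,\<nu> + \<kappa>;b), not divided by its Beta value. It
  stays unevaluated at first because the product formula itself yields the value at b = 0.\<close>

definition kummer_beta :: "complex \<Rightarrow> complex \<Rightarrow> complex \<Rightarrow> complex" where
  "kummer_beta \<nu> \<kappa> b = (\<integral>u. of_real u powr (\<nu> - 1) * of_real (1 - u) powr (\<kappa> - 1) * exp (b * of_real u)
      \<partial>restrict_space lborel {0<..<1})"

text \<open>
  For $a = 0$ and $z = 1$ this is the relation between the Beta and Gamma functions.
\<close>

lemma laplace_product:
  fixes a z \<nu> \<kappa> :: complex
  assumes nu: "Re \<nu> > 0" "Re \<kappa> > 0" and a: "Re a = 0" and z: "Re z > 0"
  shows "(\<integral>s. of_real s powr (\<nu> - 1) * exp (- z * of_real s - 1 / 2 * (- a) * of_real s ^ 2) \<partial>restrict_space lborel {0<..}) *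
    (\<integral>t. of_real t powr (\<kappa> - 1) * exp (- z * of_real t - 1 / 2 * a * of_real t ^ 2) \<partial>restrict_space lborel {0<..})
    = (\<integral>x. of_real x powr (\<nu> + \<kappa> - 1) * exp (- z * of_real x - 1 / 2 * a * of_real x ^ 2) * kummer_beta \<nu> \<kappa> (a * of_real x ^ 2)
        \<partial>restrict_space lborel {0<..})"
proof -
  define p q where "p = (\<lambda>s::real. of_real s powr (\<nu> - 1) * exp (- z * of_real s - 1 / 2 * (- a) * of_real s ^ 2))"
    and "q = (\<lambda>t::real. of_real t powr (\<kappa> - 1) * exp (- z * of_real t - 1 / 2 * a * of_real t ^ 2))"
  define P Q where "P = (\<lambda>s. indicat_real {0<..} s *\<^sub>R p s)" and "Q = (\<lambda>s. indicat_real {0<..} s *\<^sub>R q s)"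
  have "integrable (restrict_space lborel {0<..}) p"
    using nu a z unfolding p_def
    by (intro integrable_powr_exp_bound[of "Re \<nu>" "Re z" _ 1] continuous_intros)
      (auto simp: norm_mult norm_powr_real_powr simp flip: of_real_power)
  then have P: "integrable lborel P" "integral\<^sup>L (restrict_space lborel {0<..}) p = integral\<^sup>L lborel P"
    by (simp_all add: P_def integrable_restrict_space integral_restrict_space)
  have "integrable (restrict_space lborel {0<..}) q"
    using nu a z unfolding q_def
    by (intro integrable_powr_exp_bound[of "Re \<kappa>" "Re z" _ 1] continuous_intros)
      (auto simp: norm_mult norm_powr_real_powr simp flip: of_real_power)
  then have Q: "integrable lborel Q" "integral\<^sup>L (restrict_space lborel {0<..}) q = integral\<^sup>L lborel Q"
    by (simp_all add: Q_def integrable_restrict_space integral_restrict_space)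
  have inner: "(\<integral>s. P s * Q (x - s) \<partial>lborel) = indicat_real {0<..} x *\<^sub>R
      (of_real x powr (\<nu> + \<kappa> - 1) * exp (- z * of_real x - 1 / 2 * a * of_real x ^ 2) * kummer_beta \<nu> \<kappa> (a * of_real x ^ 2))" for x
  proof (cases "x > 0")
    case False
    then have 0: "P s * Q (x - s) = 0" for s
      by (auto simp: P_def Q_def indicator_def)
    show ?thesis unfolding 0 using False by simp
  next
    case True
    let ?c = "of_real x powr (\<nu> + \<kappa> - 2) * exp (- z * of_real x - 1 / 2 * a * of_real x ^ 2)"
    let ?k = "\<lambda>u::real. of_real u powr (\<nu> - 1) * of_real (1 - u) powr (\<kappa> - 1) * exp (a * of_real x ^ 2 * of_real u) :: complex"
    \<comment> \<open>Under s = xu the supports of \<open>P\<close> and \<open>Q\<close> together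
      restrict u to (0,1); outside, both sides vanish.\<close>
    have eq: "P (x * u) * Q (x - x * u) = ?c * (indicat_real {0<..<1} u *\<^sub>R ?k u)" for u
    proof (cases "0 < u \<and> u < 1")
      case False
      then consider "u \<le> 0" | "u \<ge> 1" by linarith
      then have "x * u \<le> 0 \<or> x - x * u \<le> 0"
        using True by cases (auto simp: mult_le_0_iff)
      then have "P (x * u) * Q (x - x * u) = 0"
        by (auto simp: P_def Q_def)
      moreover have "indicat_real {0<..<1} u = 0" using False by auto
      ultimately show ?thesis by simp
    next
      case u: True
      have "x - x * u = x * (1 - u)" by (simp add: algebra_simps)
      moreover have "x * u > 0" "x * (1 - u) > 0" using True u by auto
      ultimately have "P (x * u) * Q (x - x * u) = p (x * u) * q (x * (1 - u))"
        by (simp add: P_def Q_def)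
      also have "\<dots> = (of_real (x * u) powr (\<nu> - 1) * of_real (x * (1 - u)) powr (\<kappa> - 1)) *
         exp ((- z * of_real (x * u) - 1 / 2 * (- a) * of_real (x * u) ^ 2)
            + (- z * of_real (x * (1 - u)) - 1 / 2 * a * of_real (x * (1 - u)) ^ 2))"
        unfolding p_def q_def exp_add by (simp only: mult_ac)
      \<comment> \<open>With s = xu and t = x(1 - u) one has s^2 - t^2 = (s + t)(s - t) = x^2(2u -
        1), so u enters the exponent only linearly.\<close>
      also have "(- z * of_real (x * u) - 1 / 2 * (- a) * of_real (x * u) ^ 2)
            + (- z * of_real (x * (1 - u)) - 1 / 2 * a * of_real (x * (1 - u)) ^ 2)
         = (- z * of_real x - 1 / 2 * a * of_real x ^ 2) + a * of_real x ^ 2 * of_real u"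
        by (simp add: field_simps power2_eq_square)
      also have "of_real (x * u) powr (\<nu> - 1) = of_real x powr (\<nu> - 1) * of_real u powr (\<nu> - 1)"
        using True u by (simp only: of_real_mult) (intro powr_times_real, auto)
      also have "of_real (x * (1 - u)) powr (\<kappa> - 1) = of_real x powr (\<kappa> - 1) * of_real (1 - u) powr (\<kappa> - 1)"
        using True u by (simp only: of_real_mult) (intro powr_times_real, auto simp del: of_real_diff)
      finally have "P (x * u) * Q (x - x * u) = (of_real x powr (\<nu> - 1) * of_real x powr (\<kappa> - 1)) *
           exp (- z * of_real x - 1 / 2 * a * of_real x ^ 2) * ?k u"
        unfolding exp_add by (simp only: mult_ac)
      also have "of_real x powr (\<nu> - 1) * of_real x powr (\<kappa> - 1) = (of_real x powr (\<nu> + \<kappa> - 2) :: complex)"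
        using powr_add[of "of_real x" "\<nu> - 1" "\<kappa> - 1"] by (simp add: algebra_simps)
      finally show ?thesis using u by simp
    qed
    have "(\<integral>s. P s * Q (x - s) \<partial>lborel) = x *\<^sub>R (\<integral>u. P (x * u) * Q (x - x * u) \<partial>lborel)"
      using lborel_integral_real_affine[of x "\<lambda>s. P s * Q (x - s)" 0] True by simp
    also have "\<dots> = x *\<^sub>R (?c * (\<integral>u. indicat_real {0<..<1} u *\<^sub>R ?k u \<partial>lborel))"
      unfolding eq integral_mult_right_zero ..
    also have "(\<integral>u. indicat_real {0<..<1} u *\<^sub>R ?k u \<partial>lborel) = kummer_beta \<nu> \<kappa> (a * of_real x ^ 2)"
      unfolding kummer_beta_def by (subst integral_restrict_space) auto
    also have "x *\<^sub>R (?c * kummer_beta \<nu> \<kappa> (a * of_real x ^ 2)) =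
       (of_real x * of_real x powr (\<nu> + \<kappa> - 2)) * exp (- z * of_real x - 1 / 2 * a * of_real x ^ 2) * kummer_beta \<nu> \<kappa> (a * of_real x ^ 2)"
      by (simp add: scaleR_conv_of_real)
    \<comment> \<open>The Jacobian x of s = xu supplies the missing power.\<close>
    also have "of_real x * of_real x powr (\<nu> + \<kappa> - 2) = (of_real x powr (\<nu> + \<kappa> - 1) :: complex)"
      using True powr_add[of "of_real x" 1 "\<nu> + \<kappa> - 2"] by simp
    finally show ?thesis using True by simp
  qed
  have "integral\<^sup>L (restrict_space lborel {0<..}) p * integral\<^sup>L (restrict_space lborel {0<..}) q
     = (\<integral>x. (\<integral>s. P s * Q (x - s) \<partial>lborel) \<partial>lborel)"
    unfolding P(2) Q(2) by (rule lborel_integral_mult_convolution[OF P(1) Q(1)])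
  also have "\<dots> = (\<integral>x. of_real x powr (\<nu> + \<kappa> - 1) * exp (- z * of_real x - 1 / 2 * a * of_real x ^ 2) * kummer_beta \<nu> \<kappa> (a * of_real x ^ 2)
        \<partial>restrict_space lborel {0<..})"
    unfolding inner by (subst integral_restrict_space) auto
  finally show ?thesis by (simp only: p_def q_def)
qed

section \<open>Evaluation of Euler's integral\<close>

lemma kummer_beta_0:
  assumes "Re \<nu> > 0" "Re \<kappa> > 0"
  shows "kummer_beta \<nu> \<kappa> 0 = Gamma \<nu> * Gamma \<kappa> / Gamma (\<nu> + \<kappa>)"
proof -
  have "Gamma \<nu> * Gamma \<kappa> = Gamma (\<nu> + \<kappa>) * kummer_beta \<nu> \<kappa> 0"
    using laplace_product[OF assms, of 0 1] Gamma_integral_lborel(2)[OF assms(1)]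
      Gamma_integral_lborel(2)[OF assms(2)] Gamma_integral_lborel(2)[of "\<nu> + \<kappa>"] assms
    by simp
  moreover have "Gamma (\<nu> + \<kappa>) \<noteq> 0"
    using assms Re_pos_imp_not_nonpos_Ints[of "\<nu> + \<kappa>"] by (simp add: Gamma_eq_zero_iff)
  ultimately show ?thesis by (simp add: field_simps)
qed

text \<open>Expanding e^{bu} shifts \<nu> to \<nu> + n in the n-th term, which is then a Beta value;
  the quotients of Gamma values are the Pochhammer symbols of \<Phi>.\<close>

lemma kummer_beta_eq:
  assumes nu: "Re \<nu> > 0" "Re \<kappa> > 0"
  shows "kummer_beta \<nu> \<kappa> b = Gamma \<nu> * Gamma \<kappa> / Gamma (\<nu> + \<kappa>) * kummer_Phi \<nu> (\<nu> + \<kappa>) b"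
proof -
  let ?M = "restrict_space lborel {0::real<..<1}"
  define g where "g = (\<lambda>u::real. of_real u powr (\<nu> - 1) * of_real (1 - u) powr (\<kappa> - 1) :: complex)"
  have cont: "continuous_on {0<..<1} g"
    unfolding g_def by (intro continuous_intros) (auto simp: complex_nonpos_Reals_iff)
  have "integrable ?M (\<lambda>u. norm (g u))"
  proof -
    have "((\<lambda>t. t powr (Re \<nu> - 1) * (1 - t) powr (Re \<kappa> - 1)) has_integral Beta (Re \<nu>) (Re \<kappa>)) {0<..<1}"
      using has_integral_Beta_real[OF nu] by (simp add: has_integral_Icc_iff_Ioo)
    then have "(\<lambda>t. t powr (Re \<nu> - 1) * (1 - t) powr (Re \<kappa> - 1)) absolutely_integrable_on {0<..<1}"
      by (intro nonnegative_absolutely_integrable_1) auto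
    then have "set_integrable lborel {0<..<1} (\<lambda>t. t powr (Re \<nu> - 1) * (1 - t) powr (Re \<kappa> - 1))"
      unfolding set_integrable_def by (subst (asm) integrable_completion) auto
    then have "integrable ?M (\<lambda>t. t powr (Re \<nu> - 1) * (1 - t) powr (Re \<kappa> - 1))"
      by (simp add: set_integrable_def integrable_restrict_space)
    then show ?thesis
      by (rule Bochner_Integration.integrable_cong[THEN iffD1, rotated 2])
        (auto simp: g_def space_restrict_space norm_mult norm_powr_real_powr simp del: of_real_diff)
  qed
  note int_g = this
  have "(\<lambda>n. \<integral>u. g u * (b * of_real u) ^ n / fact n \<partial>?M) sums (\<integral>u. g u * exp (b * of_real u) \<partial>?M)"
  proof (rule sums_integral_exp)
    show [measurable]: "g \<in> borel_measurable ?M" "(\<lambda>u. b * of_real u) \<in> borel_measurable ?M"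
      using cont by (auto intro!: borel_measurable_restrict_lborel continuous_intros)
    show "integrable ?M (\<lambda>u. norm (g u) * exp (norm (b * of_real u)))"
    proof (rule Bochner_Integration.integrable_bound)
      show "integrable ?M (\<lambda>u. exp (norm b) * norm (g u))"
        using int_g by simp
      show "AE u in ?M. norm (norm (g u) * exp (norm (b * of_real u))) \<le> norm (exp (norm b) * norm (g u))"
        by (intro AE_I2) (auto simp: space_restrict_space norm_mult mult.commute intro!: mult_left_mono mult_left_le_one_le)
    qed measurable
  qed
  moreover have "(\<integral>u. g u * (b * of_real u) ^ n / fact n \<partial>?M) =
     Gamma \<nu> * Gamma \<kappa> / Gamma (\<nu> + \<kappa>) * (pochhammer \<nu> n / pochhammer (\<nu> + \<kappa>) n * (b ^ n / fact n))" for n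
  proof -
    \<comment> \<open>The trivial factor e^{0u} is kept so that the integral is literally
      \<open>kummer_beta\<close> at 0.\<close>
    have "(\<integral>u. g u * (b * of_real u) ^ n / fact n \<partial>?M) =
      (\<integral>u. b ^ n / fact n * (of_real u powr (\<nu> + of_nat n - 1) * of_real (1 - u) powr (\<kappa> - 1) * exp (0 * of_real u)) \<partial>?M)"
    proof (rule Bochner_Integration.integral_cong[OF refl])
      fix u assume "u \<in> space ?M"
      then have "of_real u powr (\<nu> + of_nat n - 1) = of_real u powr (\<nu> - 1) * complex_of_real u ^ n"
        using powr_add[of "of_real u" "\<nu> - 1" "of_nat n"]
        by (simp add: space_restrict_space powr_nat algebra_simps)
      then show "g u * (b * of_real u) ^ n / fact n = b ^ n / fact n *
          (of_real u powr (\<nu> + of_nat n - 1) * of_real (1 - u) powr (\<kappa> - 1) * exp (0 * of_real u))"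
        by (simp only: g_def power_mult_distrib) simp
    qed
    also have "\<dots> = b ^ n / fact n * kummer_beta (\<nu> + of_nat n) \<kappa> 0"
      unfolding kummer_beta_def by (rule integral_mult_right_zero)
    also have "kummer_beta (\<nu> + of_nat n) \<kappa> 0 = Gamma (\<nu> + of_nat n) * Gamma \<kappa> / Gamma (\<nu> + \<kappa> + of_nat n)"
      using nu by (subst kummer_beta_0) (auto simp: add_ac)
    also have "Gamma (\<nu> + of_nat n) = Gamma \<nu> * pochhammer \<nu> n"
      using Re_pos_imp_not_nonpos_Ints[OF nu(1)] by (simp add: pochhammer_Gamma Gamma_eq_zero_iff)
    also have "Gamma (\<nu> + \<kappa> + of_nat n) = Gamma (\<nu> + \<kappa>) * pochhammer (\<nu> + \<kappa>) n"
      using Re_pos_imp_not_nonpos_Ints[of "\<nu> + \<kappa>"] nu by (simp add: pochhammer_Gamma Gamma_eq_zero_iff)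
    finally show ?thesis by (simp add: mult_ac)
  qed
  moreover have "(\<integral>u. g u * exp (b * of_real u) \<partial>?M) = kummer_beta \<nu> \<kappa> b"
    by (simp add: kummer_beta_def g_def)
  ultimately have "(\<lambda>n. Gamma \<nu> * Gamma \<kappa> / Gamma (\<nu> + \<kappa>) *
      (pochhammer \<nu> n / pochhammer (\<nu> + \<kappa>) n * (b ^ n / fact n))) sums kummer_beta \<nu> \<kappa> b"
    by (simp only:)
  then show ?thesis
    using sums_mult[OF kummer_sums] by (rule sums_unique2)
qed

subsection \<open>Analytic continuation in the first parameter\<close>

context
  fixes a \<mu> z :: complex
  assumes a: "Re a = 0" "a \<noteq> 0" and mu: "Re \<mu> > 0" and z: "Re z > 0"
begin

definition integrand :: "complex \<Rightarrow> real \<Rightarrow> complex" where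
  "integrand \<nu> x = of_real x powr (\<mu> - 1) * exp (- z * of_real x - 1 / 2 * a * of_real x ^ 2)
                      * kummer_Phi \<nu> \<mu> (a * of_real x ^ 2)"

lemma continuous_on_integrand: "continuous_on {0<..} (integrand \<nu>)"
  unfolding integrand_def by (intro continuous_intros)

lemma integrand_bound:
  assumes "R \<ge> 0"
  obtains C where
    "\<And>\<nu> x. norm \<nu> \<le> R \<Longrightarrow> x > 0 \<Longrightarrow> norm (integrand \<nu> x) \<le> C * (x powr (Re \<mu> - 1) * exp (- (Re z / 2) * x))"
proof -
  \<comment> \<open>The rate Re z/2 gives away half of the decay of e^{-zx} to the growth of \<Phi>
    and keeps the other half for integrability.\<close>
  obtain C where C: "C \<ge> 0"
    "\<And>\<nu> x. norm \<nu> \<le> R \<Longrightarrow> x > 0 \<Longrightarrow> norm (kummer_Phi \<nu> \<mu> (a * of_real x ^ 2)) \<le> C * exp (Re z / 2 * x)"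
    using kummer_Phi_imag_bound[of a \<mu> "Re z / 2" R] a mu z assms Re_pos_imp_not_nonpos_Ints by auto
  show ?thesis
  proof
    fix \<nu> :: complex and x :: real
    assume nu: "norm \<nu> \<le> R" and x: "x > 0"
    have "norm (integrand \<nu> x) = x powr (Re \<mu> - 1) * exp (- Re z * x) * norm (kummer_Phi \<nu> \<mu> (a * of_real x ^ 2))"
      using x a by (simp add: integrand_def norm_mult norm_powr_real_powr flip: of_real_power)
    also have "\<dots> \<le> x powr (Re \<mu> - 1) * exp (- Re z * x) * (C * exp (Re z / 2 * x))"
      by (intro mult_left_mono C nu x) auto
    also have "\<dots> = C * (x powr (Re \<mu> - 1) * (exp (- Re z * x) * exp (Re z / 2 * x)))"
      by (simp only: mult_ac)
    also have "exp (- Re z * x) * exp (Re z / 2 * x) = exp (- (Re z / 2) * x)"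
      by (simp flip: exp_add)
    finally show "norm (integrand \<nu> x) \<le> C * (x powr (Re \<mu> - 1) * exp (- (Re z / 2) * x))" .
  qed
qed

lemma integrable_integrand: "integrable (restrict_space lborel {0<..}) (integrand \<nu>)"
proof -
  obtain C where "\<And>\<nu>' x. norm \<nu>' \<le> norm \<nu> \<Longrightarrow> x > 0 \<Longrightarrow>
      norm (integrand \<nu>' x) \<le> C * (x powr (Re \<mu> - 1) * exp (- (Re z / 2) * x))"
    using integrand_bound[of "norm \<nu>"] by auto
  from this[OF order_refl] show ?thesis
    using mu z by (intro integrable_powr_exp_bound[of "Re \<mu>" "Re z / 2"] continuous_on_integrand) auto
qed

lemma holomorphic_on_integral_integrand:
  "(\<lambda>\<nu>. integral\<^sup>L (restrict_space lborel {0<..}) (integrand \<nu>)) holomorphic_on UNIV"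
proof (rule holomorphic_on_lebesgue_integral)
  show "(\<lambda>\<nu>. integrand \<nu> x) holomorphic_on UNIV" for x
    unfolding integrand_def by (intro holomorphic_intros)
  fix w :: complex
  obtain C where C: "\<And>\<nu> x. norm \<nu> \<le> norm w + 1 \<Longrightarrow> x > 0 \<Longrightarrow>
      norm (integrand \<nu> x) \<le> C * (x powr (Re \<mu> - 1) * exp (- (Re z / 2) * x))"
    using integrand_bound[of "norm w + 1"] by auto
  have "norm u \<le> norm w + 1" if "dist w u \<le> 1" for u
    using that norm_triangle_ineq2[of u w] by (simp add: dist_norm norm_minus_commute)
  then show "\<exists>r>0. \<exists>g. cball w r \<subseteq> UNIV \<and> integrable (restrict_space lborel {0<..}) g \<and>
      (\<forall>u\<in>cball w r. \<forall>x\<in>space (restrict_space lborel {0<..}). norm (integrand u x) \<le> g x)"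
    using mu z
    by (intro exI[of _ 1] exI[of _ "\<lambda>x. C * (x powr (Re \<mu> - 1) * exp (- (Re z / 2) * x))"]
        conjI ballI C integrable_mult_right powr_exp_integrable) (auto simp: space_restrict_space)
qed (auto intro: borel_measurable_restrict_lborel continuous_on_integrand)

text \<open>In this strip both \<nu> and \<kappa> = \<mu> - \<nu> have positive real part, as the
  two Laplace transforms require.\<close>

lemma integral_integrand_strip:
  assumes nu: "Re \<nu> > 0" "Re \<nu> < Re \<mu>"
  shows "a powr (\<nu> / 2 - \<mu> / 2) / (- a) powr (\<nu> / 2) *
           parabolic_cylinder_D (- \<nu>) (z / csqrt (- a)) * parabolic_cylinder_D (\<nu> - \<mu>) (z / csqrt a)
         = 1 / Gamma \<mu> * integral\<^sup>L (restrict_space lborel {0<..}) (integrand \<nu>)"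
proof -
  let ?M = "restrict_space lborel {0::real<..}"
  define \<kappa> where "\<kappa> = \<mu> - \<nu>"
  have ka: "Re \<kappa> > 0" "\<nu> + \<kappa> = \<mu>" "- \<kappa> = \<nu> - \<mu>" "- \<kappa> / 2 = \<nu> / 2 - \<mu> / 2"
    using nu by (simp_all add: \<kappa>_def diff_divide_distrib)
  have G: "Gamma \<nu> \<noteq> 0" "Gamma \<kappa> \<noteq> 0"
    using nu ka by (simp_all add: Gamma_eq_zero_iff Re_pos_imp_not_nonpos_Ints)
  have "gaussian_laplace_rhs \<nu> z (- a) * gaussian_laplace_rhs \<kappa> z a
      = (\<integral>x. Gamma \<nu> * Gamma \<kappa> / Gamma \<mu> * integrand \<nu> x \<partial>?M)"
    using laplace_product[OF nu(1) ka(1) a(1) z] gaussian_laplace[OF nu(1) z, of "- a"]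
      gaussian_laplace[OF ka(1) z, of a] a
    unfolding kummer_beta_eq[OF nu(1) ka(1)] ka(2) integrand_def by (simp add: mult_ac)
  also have "\<dots> = Gamma \<nu> * Gamma \<kappa> * (1 / Gamma \<mu> * integral\<^sup>L ?M (integrand \<nu>))"
    by simp
  also have "gaussian_laplace_rhs \<nu> z (- a) * gaussian_laplace_rhs \<kappa> z a =
     Gamma \<nu> * Gamma \<kappa> * (a powr (\<nu> / 2 - \<mu> / 2) / (- a) powr (\<nu> / 2) *
           parabolic_cylinder_D (- \<nu>) (z / csqrt (- a)) * parabolic_cylinder_D (\<nu> - \<mu>) (z / csqrt a))
     * (exp (z ^ 2 / (4 * - a)) * exp (z ^ 2 / (4 * a)))"
  proof -
    have p: "(- a) powr (- \<nu> / 2) = 1 / (- a) powr (\<nu> / 2)"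
      using powr_minus_divide[of "- a" "\<nu> / 2"] by simp
    have alg: "(g * (1 / p) * e * d) * (g' * q * e' * d') = g * g' * (q / p * d * d') * (e * e')"
      for g p e d g' q e' d' :: complex
      by (simp add: mult_ac)
    show ?thesis
      unfolding gaussian_laplace_rhs_def ka(4) unfolding ka(3) p by (rule alg)
  qed
  \<comment> \<open>The exponents are opposite because the transforms are taken at -a and a.\<close>
  also have "exp (z ^ 2 / (4 * - a)) * exp (z ^ 2 / (4 * a)) = 1"
    unfolding exp_add[symmetric] by simp
  finally show ?thesis
    using G by (simp only: mult_1_right mult_left_cancel no_zero_divisors simp_thms)
qed

text \<open>Identity theorem in \<nu>. The left side is entire because \<open>rGamma\<close> and
  \<Phi> are entire in the index and the powers have the nonzero bases a and -a.\<close>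

lemma integral_integrand:
  "a powr (\<nu> / 2 - \<mu> / 2) / (- a) powr (\<nu> / 2) *
     parabolic_cylinder_D (- \<nu>) (z / csqrt (- a)) * parabolic_cylinder_D (\<nu> - \<mu>) (z / csqrt a)
   = 1 / Gamma \<mu> * integral\<^sup>L (restrict_space lborel {0<..}) (integrand \<nu>)"
proof (rule analytic_continuation_open[where z = \<nu>])
  show "open {\<nu>. Re \<nu> > 0 \<and> Re \<nu> < Re \<mu>}"
    by (intro open_Collect_conj open_halfspace_Re_gt open_halfspace_Re_lt)
  \<comment> \<open>The strip contains \<mu>/2, as Re \<mu> > 0.\<close>
  show "{\<nu>. Re \<nu> > 0 \<and> Re \<nu> < Re \<mu>} \<noteq> {}"
    using mu by (auto intro!: exI[of _ "\<mu> / 2"])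
  show "(\<lambda>\<nu>. a powr (\<nu> / 2 - \<mu> / 2) / (- a) powr (\<nu> / 2) *
     parabolic_cylinder_D (- \<nu>) (z / csqrt (- a)) * parabolic_cylinder_D (\<nu> - \<mu>) (z / csqrt a)) holomorphic_on UNIV"
    using a by (intro holomorphic_intros) auto
  show "(\<lambda>\<nu>. 1 / Gamma \<mu> * integral\<^sup>L (restrict_space lborel {0<..}) (integrand \<nu>)) holomorphic_on UNIV"
    by (intro holomorphic_intros holomorphic_on_integral_integrand)
qed (use integral_integrand_strip in auto)

end

text \<open>Integrability is asserted along with the equation, since the integral of a
  non-integrable function is 0 by convention.\<close>

theorem theorem1:
  fixes a \<nu> \<mu> z :: complex
  assumes "a \<noteq> 0" and "Re a = 0" and "Re \<mu> > 0" and "Re z > 0"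
  defines "f \<equiv> \<lambda>x::real. of_real x powr (\<mu> - 1) * exp (- z * of_real x - 1 / 2 * a * of_real x ^ 2)
                           * kummer_Phi \<nu> \<mu> (a * of_real x ^ 2)"
  shows "set_integrable lborel {0<..} f \<and>
         a powr (\<nu> / 2 - \<mu> / 2) / (- a) powr (\<nu> / 2) *
           parabolic_cylinder_D (- \<nu>) (z / csqrt (- a)) *
           parabolic_cylinder_D (\<nu> - \<mu>) (z / csqrt a)
         = 1 / Gamma \<mu> * (LINT x:{0<..}|lborel. f x)"
proof -
  have "f = integrand a \<mu> z \<nu>"
    using assms by (simp add: fun_eq_iff integrand_def)
  then show ?thesis
    using integrable_integrand[of a \<mu> z \<nu>] integral_integrand[of a \<mu> z \<nu>] assms(1-4)
    by (simp add: set_integrable_iff_restrict_space set_lebesgue_integral_restrict_space)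
qed

end
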